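(* Domino shuffling on the half-hexagon preserves the uniform distribution: for every $n\ge1$, $\psi\mu_{n-1}=\mu_n$, where $\psi:\mathbb C\,\mathrm{HH}(n-1)\to\mathbb C\,\mathrm{HH}(n)$ is the linear map induced by the half-hexagon domino shuffle and $\mu_m=\frac{1}{|\mathrm{HH}(m)|}\sum_{\pi\in\mathrm{HH}(m)}\pi$ is the vector of the uniform probability distribution on $\mathrm{HH}(m)$.
   Context: Staircase tableaux. For $n\ge0$, $\mathrm{ST}(n)$ is the set of integer arrays $(g_{ij})_{0\le j\le i\le n}$ with bottom row $g_{n,j}=2j+1$ ($0\le j\le n$) satisfying the interlacing conditions $g_{i,j}\le g_{i-1,j}<g_{i,j+1}$ for all $1\le i\le n$, $0\le j\le i-1$. Half-hexagon matchings. Let $v=(1,0)$, $w=\frac12(1,\sqrt3)$, and let $\mathcal L$ be the triangular lattice with vertex set $\mathbb Zv+\mathbb Zw$ and edges between vertices at unit distance. Let $R_n$ be the union of the trapezoid with corners $nv,nw,n(w-v),-nv$ and the $n$ trapezoids with corners $(2i-n+1)v+v$, $(2i-n+1)v-v$, $(2i-n+1)v-w$, $(2i-n+1)v+v-w$, $0\le i\le n-1$. The half-hexagon graph $R_n^\vee$ is the subgraph of the planar dual of $\mathcal L$ induced by the dual vertices lying in $R_n$, and $\mathrm{HH}(n)$ is its set of perfect matchings ($\mathrm{HH}(0)$ has a single element, the empty matching). $\mathrm{HH}(n)$ is identified with $\mathrm{ST}(n)$ via a bijection: the vertical edges of $R_n^\vee$ are centred at $(-n-\frac12+j)v+(n-i)w$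 with row index $1\le i\le n$ and position $1\le j\le n+i$; a perfect matching is determined by its vertical edges, row $i$ contains exactly $i$ of them, and $g_{i-1,0}<\dots<g_{i-1,i-1}$ are their positions (row $n$ of the tableau being the fixed row $1,3,\dots,2n+1$). All maps below are defined on tableaux through this identification. Half-hexagon domino shuffle. Input: $(g_{ij})\in\mathrm{ST}(n)$ and independent random variables $\xi_{ij}$ taking values $0,1$ with probability $\frac12$ each. Output: $(h_{ij})\in\mathrm{ST}(n+1)$, computed as follows. For $i$ from $0$ to $n$, and for $j$ from $0$ to $i$: - if $j<i$ and $g_{i,j}=h_{i-1,j}$, set $h_{i,j}=g_{i,j}$; - else if $j>0$ and $g_{i,j}=h_{i-1,j-1}$, set $h_{i,j}=g_{i,j}+1$; - else set $h_{i,j}=g_{i,j}+\xi_{i,j}$. Finally set $h_{n+1,j}=2j+1$ for $0\le j\le n+1$. For $\pi\in\mathrm{HH}(n)$ and $\pi'\in\mathrm{HH}(n+1)$ let $P(\pi\to\pi')$ be the probability that the shuffle outputs $\pi'$ on input $\pi$. $\mathbb C\,\mathrm{HH}(n)$ is the complex vector space with orthonormal basis $\mathrm{HH}(n)$ and inner product $\langle\cdot,\cdot\rangle$, and $\psi:\mathbb C\,\mathrm{HH}(n)\to\mathbb C\,\mathrm{HH}(n+1)$ is the linear map with $\langle\psi(\pi),\pi'\rangle=P(\pi\to\pi')$, i.e. $\psi(\pi)=\sum_{\pi'}P(\pi\to\pi')\,\pi'$. *)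

theory Defs
  imports "HOL-Probability.Probability"
begin

section \<open>Staircase tableaux and the shuffle\<close>

text \<open>Triangular arrays are functions on pairs of indices, set to \<open>0\<close> outside the triangle
  \<open>0 \<le> j \<le> i \<le> n\<close>, so that equality of arrays is equality of functions.\<close>

type_synonym tableau = "nat \<Rightarrow> nat \<Rightarrow> int"

definition ST :: "nat \<Rightarrow> tableau set" where
  "ST n = {g. (\<forall>i j. \<not> (j \<le> i \<and> i \<le> n) \<longrightarrow> g i j = 0) \<and>
              (\<forall>j\<le>n. g n j = 2 * int j + 1) \<and>
              (\<forall>i\<in>{1..n}. \<forall>j\<le>i - 1. g i j \<le> g (i - 1) j \<and> g (i - 1) j < g i (j + 1))}"

text \<open>The value \<open>h\<^bsub>i,j\<^esub>\<close> for \<open>j \<le> i \<le> n\<close>; in row \<open>0\<close> (where \<open>j = 0\<close>) neither of the first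
  two cases applies.\<close>

fun shuffle_entry :: "tableau \<Rightarrow> (nat \<times> nat \<Rightarrow> int) \<Rightarrow> nat \<Rightarrow> nat \<Rightarrow> int" where
  "shuffle_entry g \<xi> 0 j = g 0 j + \<xi> (0, j)"
| "shuffle_entry g \<xi> (Suc i) j =
     (if j < Suc i \<and> g (Suc i) j = shuffle_entry g \<xi> i j then g (Suc i) j
      else if j > 0 \<and> g (Suc i) j = shuffle_entry g \<xi> i (j - 1) then g (Suc i) j + 1
      else g (Suc i) j + \<xi> (Suc i, j))"

definition shuffle :: "nat \<Rightarrow> tableau \<Rightarrow> (nat \<times> nat \<Rightarrow> int) \<Rightarrow> tableau" where
  "shuffle n g \<xi> = (\<lambda>i j.
     if j \<le> i \<and> i \<le> n then shuffle_entry g \<xi> i j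
     else if i = n + 1 \<and> j \<le> n + 1 then 2 * int j + 1
     else 0)"

text \<open>The shuffle is well defined as a map from \<open>ST n\<close> to \<open>ST (n + 1)\<close>.\<close>

lemma shuffle_entry_bounds:
  assumes "\<And>p. \<xi> p \<in> {0, 1}"
  shows "g i j \<le> shuffle_entry g \<xi> i j \<and> shuffle_entry g \<xi> i j \<le> g i j + 1"
  using assms by (cases i) (auto, (metis insertE singletonD zero_le_one order_refl)+)

lemma shuffle_entry_interlacing:
  assumes g: "g \<in> ST n" and x: "\<And>p. \<xi> p \<in> {0, 1}"
  shows "Suc i \<le> n \<Longrightarrow> j \<le> i \<Longrightarrow>
    shuffle_entry g \<xi> (Suc i) j \<le> shuffle_entry g \<xi> i j \<and>
    shuffle_entry g \<xi> i j < shuffle_entry g \<xi> (Suc i) (Suc j)"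
proof (induction i arbitrary: j)
  case (0 j)
  have gi: "g (Suc 0) 0 \<le> g 0 0 \<and> g 0 0 < g (Suc 0) (Suc 0)"
    using g 0 by (auto simp: ST_def dest!: bspec[of _ _ "Suc 0"])
  have "\<xi> (0, 0) = 0 \<or> \<xi> (0, 0) = 1" "\<xi> (Suc 0, 0) = 0 \<or> \<xi> (Suc 0, 0) = 1"
       "\<xi> (Suc 0, Suc 0) = 0 \<or> \<xi> (Suc 0, Suc 0) = 1"
    using x by auto
  with gi 0 show ?case by auto
next
  case (Suc i j)
  have gi: "g (Suc (Suc i)) j \<le> g (Suc i) j \<and> g (Suc i) j < g (Suc (Suc i)) (Suc j)"
    using g Suc.prems by (auto simp: ST_def dest!: bspec[of _ _ "Suc (Suc i)"])
  have b: "\<And>i j. g i j \<le> shuffle_entry g \<xi> i j \<and> shuffle_entry g \<xi> i j \<le> g i j + 1"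
    using shuffle_entry_bounds[of \<xi> g] x by blast
  have x1: "\<xi> (Suc (Suc i), j) = 0 \<or> \<xi> (Suc (Suc i), j) = 1"
       "\<xi> (Suc (Suc i), Suc j) = 0 \<or> \<xi> (Suc (Suc i), Suc j) = 1"
    using x by auto
  have inc: "shuffle_entry g \<xi> (Suc i) j < shuffle_entry g \<xi> (Suc i) (Suc j)" if "j \<le> i"
    using Suc.IH[of j] Suc.prems that by linarith
  have up: "shuffle_entry g \<xi> (Suc (Suc i)) j \<le> shuffle_entry g \<xi> (Suc i) j"
  proof (cases "g (Suc (Suc i)) j = shuffle_entry g \<xi> (Suc i) j")
    case True
    then show ?thesis using Suc.prems by (subst shuffle_entry.simps(2)) (simp del: shuffle_entry.simps)
  next
    case False
    then show ?thesis using b[of "Suc (Suc i)" j] b[of "Suc i" j] gi by linarith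
  qed
  have "shuffle_entry g \<xi> (Suc i) j < shuffle_entry g \<xi> (Suc (Suc i)) (Suc j)"
  proof (cases "g (Suc (Suc i)) (Suc j) = shuffle_entry g \<xi> (Suc i) j")
    case True
    have "\<not> (Suc j < Suc (Suc i) \<and> g (Suc (Suc i)) (Suc j) = shuffle_entry g \<xi> (Suc i) (Suc j))"
      using inc True by auto
    then show ?thesis using True
      by (subst shuffle_entry.simps(2)) (simp del: shuffle_entry.simps)
  next
    case False
    then show ?thesis using b[of "Suc (Suc i)" "Suc j"] b[of "Suc i" j] gi by linarith
  qed
  with up show ?case ..
qed

lemma shuffle_in_ST:
  assumes g: "g \<in> ST n" and x: "\<And>p. \<xi> p \<in> {0, 1}"
  shows "shuffle n g \<xi> \<in> ST (n + 1)"
proof -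
  have b: "\<And>i j. g i j \<le> shuffle_entry g \<xi> i j \<and> shuffle_entry g \<xi> i j \<le> g i j + 1"
    using shuffle_entry_bounds[of \<xi> g] x by blast
  have "shuffle n g \<xi> i j \<le> shuffle n g \<xi> (i - 1) j \<and>
        shuffle n g \<xi> (i - 1) j < shuffle n g \<xi> i (j + 1)"
    if i: "i \<in> {1..n + 1}" and j: "j \<le> i - 1" for i j
  proof (cases "i = n + 1")
    case True
    have "g n j = 2 * int j + 1" using g j True by (simp add: ST_def)
    then show ?thesis using b[of n j] True j by (simp add: shuffle_def)
  next
    case False
    then obtain k where "i = Suc k" "Suc k \<le> n" "j \<le> k"
      using i j by (cases i) auto
    then show ?thesis using shuffle_entry_interlacing[OF g x, of k j]
      by (simp add: shuffle_def del: shuffle_entry.simps)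
  qed
  then show ?thesis by (simp add: ST_def) (simp add: shuffle_def)
qed

definition coins :: "nat \<Rightarrow> (nat \<times> nat \<Rightarrow> int) pmf" where
  "coins n = Pi_pmf {(i, j). j \<le> i \<and> i \<le> n} 0 (\<lambda>_. pmf_of_set {0, 1})"


section \<open>The half-hexagon graph\<close>

definition lat_v :: complex where "lat_v = 1"

definition lat_w :: complex where "lat_w = Complex (1 / 2) (sqrt 3 / 2)"

definition tri_lattice :: "complex set" where
  "tri_lattice = {of_int a * lat_v + of_int b * lat_w | a b. True}"

text \<open>The faces of the triangular lattice are its unit triangles, each represented by its set of
  corners. These are the vertices of the planar dual; two of them are adjacent when they share a
  side. A dual vertex is placed at the centroid of its triangle and a dual edge is centred at the
  midpoint of its two ends, which is also the midpoint of the shared side.\<close>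

type_synonym face = "complex set"
type_synonym dual_edge = "face set"
type_synonym matching = "dual_edge set"

definition tri_faces :: "face set" where
  "tri_faces = {F. F \<subseteq> tri_lattice \<and> card F = 3 \<and> (\<forall>p\<in>F. \<forall>q\<in>F. p \<noteq> q \<longrightarrow> dist p q = 1)}"

definition face_centre :: "face \<Rightarrow> complex" where
  "face_centre F = (\<Sum>p\<in>F. p) / 3"

definition edge_centre :: "dual_edge \<Rightarrow> complex" where
  "edge_centre e = (\<Sum>F\<in>e. face_centre F) / 2"

definition hh_region :: "nat \<Rightarrow> complex set" where
  "hh_region n =
     convex hull {of_nat n * lat_v, of_nat n * lat_w, of_nat n * (lat_w - lat_v), - of_nat n * lat_v}
     \<union> (\<Union>i<n. let c = of_int (2 * int i - int n + 1) * lat_v in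
           convex hull {c + lat_v, c - lat_v, c - lat_w, c + lat_v - lat_w})"

definition hh_vertices :: "nat \<Rightarrow> face set" where
  "hh_vertices n = {F \<in> tri_faces. face_centre F \<in> hh_region n}"

definition hh_edges :: "nat \<Rightarrow> dual_edge set" where
  "hh_edges n = {{F, G} | F G. F \<in> hh_vertices n \<and> G \<in> hh_vertices n \<and> card (F \<inter> G) = 2}"

definition HH :: "nat \<Rightarrow> matching set" where
  "HH n = {M. M \<subseteq> hh_edges n \<and> (\<forall>F\<in>hh_vertices n. \<exists>!e. e \<in> M \<and> F \<in> e)}"


section \<open>Matchings as tableaux\<close>

definition vertical_centre :: "nat \<Rightarrow> nat \<Rightarrow> nat \<Rightarrow> complex" where
  "vertical_centre n i j =
     (- of_nat n - 1 / 2 + of_nat j) * lat_v + (of_nat n - of_nat i) * lat_w"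

text \<open>Positions of the edges of a matching in row \<open>i\<close> of vertical edges, \<open>1 \<le> i \<le> n\<close>.\<close>

definition vertical_positions :: "nat \<Rightarrow> matching \<Rightarrow> nat \<Rightarrow> nat set" where
  "vertical_positions n M i =
     {j. 1 \<le> j \<and> j \<le> n + i \<and> (\<exists>e\<in>M. edge_centre e = vertical_centre n i j)}"

text \<open>The bijection from \<open>HH n\<close> to \<open>ST n\<close>: row \<open>i < n\<close> of the tableau lists in increasing order
  the \<open>i + 1\<close> positions in row \<open>i + 1\<close> of vertical edges.\<close>

definition tableau_of :: "nat \<Rightarrow> matching \<Rightarrow> tableau" where
  "tableau_of n M = (\<lambda>i j.
     if j \<le> i \<and> i < n then int (sorted_list_of_set (vertical_positions n M (i + 1)) ! j)
     else if i = n \<and> j \<le> n then 2 * int j + 1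
     else 0)"


section \<open>The linear map of the shuffle\<close>

definition shuffle_prob :: "nat \<Rightarrow> matching \<Rightarrow> matching \<Rightarrow> real" where
  "shuffle_prob n M M' =
     measure_pmf.prob (coins n) {\<xi>. shuffle n (tableau_of n M) \<xi> = tableau_of (n + 1) M'}"

text \<open>Vectors of \<open>\<complex> HH(n)\<close> are coefficient functions vanishing outside \<open>HH n\<close>.\<close>

definition psi :: "nat \<Rightarrow> (matching \<Rightarrow> complex) \<Rightarrow> (matching \<Rightarrow> complex)" where
  "psi n f = (\<lambda>M'. if M' \<in> HH (n + 1)
     then \<Sum>M\<in>HH n. f M * of_real (shuffle_prob n M M') else 0)"

definition mu :: "nat \<Rightarrow> matching \<Rightarrow> complex" where
  "mu m = (\<lambda>M. if M \<in> HH m then 1 / of_nat (card (HH m)) else 0)"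

end

theory Submission
  imports Defs
begin

text \<open>Fix the output \<open>h\<close>. The probability of \<open>g \<rightarrow> h\<close> is a product over the rows of \<open>g\<close>. Summing over
  the rows of \<open>g\<close> from the top, one finds by induction that the total weight of the rows \<open>0..i\<close> with
  row \<open>i\<close> equal to \<open>r\<close> is \<open>2\<^sup>-\<^sup>(\<^sup>i\<^sup>+\<^sup>1\<^sup>)\<close> if all \<open>h\<^sub>i\<^sub>j - r\<^sub>j\<close> are \<open>0\<close> or \<open>1\<close>, and \<open>0\<close> otherwise. For
  \<open>i = n\<close> the row of \<open>g\<close> is fixed and the sum is \<open>2\<^sup>-\<^sup>(\<^sup>n\<^sup>+\<^sup>1\<^sup>)\<close>, which does not depend on \<open>h\<close>.

  The matchings are identified with the tableaux strip by strip. The strip between two consecutive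
  rows of vertical edges is a path of triangles, and the path edges in a matching are determined by
  the numbers of vertical edges to their left in the two rows; a matching exists exactly when the two
  rows interlace.\<close>

section \<open>Summation over the input tableau\<close>

text \<open>Here \<open>q\<close> is the output row \<open>i - 1\<close>, \<open>r\<close> the input
  row \<open>i\<close> and \<open>c\<close> the coin. For \<open>i = j = 0\<close> neither forcing
  case can apply, so the truncation \<open>0 - 1 = 0\<close> in later uses is harmless.\<close>

definition entry :: "nat \<Rightarrow> (nat \<Rightarrow> int) \<Rightarrow> (nat \<Rightarrow> int) \<Rightarrow> nat \<Rightarrow> int \<Rightarrow> int" where
  "entry i q r j c =
     (if j < i \<and> r j = q j then r j
      else if j > 0 \<and> r j = q (j - 1) then r j + 1
      else r j + c)"

lemma shuffle_entry_eq_entry: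
  "j \<le> i \<Longrightarrow>
    shuffle_entry g \<xi> i j = entry i (shuffle_entry g \<xi> (i - 1)) (g i) j (\<xi> (i, j))"
  by (cases i) (auto simp: entry_def)

lemma entry_cong:
  assumes "\<And>k. k < i \<Longrightarrow> q k = q' k" "j \<le> i"
  shows "entry i q r j c = entry i q' r j c"
proof -
  have "j > 0 \<Longrightarrow> q (j - 1) = q' (j - 1)" using assms by simp
  moreover have "j < i \<Longrightarrow> q j = q' j" using assms by simp
  ultimately show ?thesis by (auto simp: entry_def)
qed

text \<open>Once the output is prescribed, the previous output row can be replaced by
  \<open>h (i - 1)\<close>. The recursion then falls apart into one condition per coin, which makes
  independence usable.\<close>

lemma shuffle_eq_iff:
  assumes h: "h \<in> ST (n + 1)"
  shows "shuffle n g \<xi> = h \<longleftrightarrow>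
    (\<forall>i\<le>n. \<forall>j\<le>i. entry i (h (i - 1)) (g i) j (\<xi> (i, j)) = h i j)"
    (is "?L \<longleftrightarrow> ?R")
proof
  assume L: ?L
  have eq: "h i j = shuffle_entry g \<xi> i j" if "i \<le> n" "j \<le> i" for i j
    using that by (simp add: L[symmetric] shuffle_def)
  show ?R
  proof (intro allI impI)
    fix i j assume ij: "i \<le> n" "j \<le> i"
    have "entry i (h (i - 1)) (g i) j (\<xi> (i, j))
        = entry i (shuffle_entry g \<xi> (i - 1)) (g i) j (\<xi> (i, j))"
      using ij by (intro entry_cong) (auto intro!: eq)
    then show "entry i (h (i - 1)) (g i) j (\<xi> (i, j)) = h i j"
      using ij by (simp only: eq shuffle_entry_eq_entry)
  qed
next
  assume R: ?R
  have eq: "i \<le> n \<Longrightarrow> j \<le> i \<Longrightarrow> shuffle_entry g \<xi> i j = h i j" for i j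
  proof (induction i arbitrary: j)
    case 0
    then show ?case using R by (auto simp: entry_def)
  next
    case (Suc i)
    have "shuffle_entry g \<xi> (Suc i) j
        = entry (Suc i) (shuffle_entry g \<xi> i) (g (Suc i)) j (\<xi> (Suc i, j))"
      using shuffle_entry_eq_entry[of j "Suc i"] Suc.prems by simp
    also have "\<dots> = entry (Suc i) (h i) (g (Suc i)) j (\<xi> (Suc i, j))"
      using Suc by (intro entry_cong) auto
    also have "\<dots> = h (Suc i) j" using R Suc.prems by force
    finally show ?case .
  qed
  show ?L
  proof (intro ext)
    fix i j
    show "shuffle n g \<xi> i j = h i j"
      using h eq[of i j] by (auto simp: shuffle_def ST_def)
  qed
qed

section \<open>Transition probabilities as products over rows\<close>

abbreviation coin :: "int pmf" where "coin \<equiv> pmf_of_set {0, 1}"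

text \<open>The probability of output row \<open>h i\<close>, given the preceding output row
  \<open>h (i - 1)\<close> and the input row \<open>r\<close>.\<close>

definition row_weight :: "tableau \<Rightarrow> nat \<Rightarrow> (nat \<Rightarrow> int) \<Rightarrow> real" where
  "row_weight h i r = (\<Prod>j\<le>i. measure_pmf.prob coin {c. entry i (h (i - 1)) r j c = h i j})"

lemma prob_shuffle:
  assumes h: "h \<in> ST (n + 1)"
  shows "measure_pmf.prob (coins n) {\<xi>. shuffle n g \<xi> = h} = (\<Prod>i\<le>n. row_weight h i (g i))"
proof -
  let ?T = "{(i, j). j \<le> i \<and> i \<le> n} :: (nat \<times> nat) set"
  let ?B = "\<lambda>(i, j). {c. entry i (h (i - 1)) (g i) j c = h i j}"
  have T: "?T = Sigma {..n} (\<lambda>i. {..i})" by auto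
  have "{\<xi>. shuffle n g \<xi> = h} = Pi ?T ?B"
    unfolding shuffle_eq_iff[OF h] by (auto simp: Pi_def)
  then have "measure_pmf.prob (coins n) {\<xi>. shuffle n g \<xi> = h}
    = (\<Prod>x\<in>?T. measure_pmf.prob coin (?B x))"
    unfolding coins_def by (simp only:) (rule measure_Pi_pmf_Pi, simp add: T)
  also have "\<dots> = (\<Prod>i\<le>n. \<Prod>j\<le>i. measure_pmf.prob coin (?B (i, j)))"
    unfolding T by (subst prod.Sigma) (auto simp: case_prod_unfold)
  finally show ?thesis by (simp add: row_weight_def)
qed

lemma prob_coin: "measure_pmf.prob coin A = (of_bool (0 \<in> A) + of_bool (1 \<in> A)) / 2"
  by (subst measure_pmf_of_set) (auto simp: Int_insert_left card_insert_if)

lemma prob_entry: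
  "measure_pmf.prob coin {c. entry i q r j c = s} =
    (if j < i \<and> r j = q j then of_bool (s = r j)
     else if j > 0 \<and> r j = q (j - 1) then of_bool (s = r j + 1)
     else of_bool (s - r j \<in> {0, 1}) / 2)"
proof -
  consider "j < i" "r j = q j" | "\<not> (j < i \<and> r j = q j)" "j > 0" "r j = q (j - 1)"
    | "\<not> (j < i \<and> r j = q j)" "\<not> (j > 0 \<and> r j = q (j - 1))" by blast
  then show ?thesis
  proof cases
    case 1
    then show ?thesis by (simp add: entry_def prob_coin eq_commute)
  next
    case 2
    then have "entry i q r j = (\<lambda>c. r j + 1)" by (intro ext) (simp add: entry_def)
    then show ?thesis using 2 by (simp only: if_False if_True prob_coin) (simp add: eq_commute)
  next
    case 3
    then have "entry i q r j = (\<lambda>c. r j + c)" by (intro ext) (auto simp add: entry_def)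
    moreover have "r j + 0 = s \<longleftrightarrow> s - r j = 0" "r j + 1 = s \<longleftrightarrow> s - r j = 1" by linarith+
    ultimately show ?thesis using 3 by (simp only: if_False prob_coin mem_Collect_eq) auto
  qed
qed

section \<open>Input rows compatible with a given output\<close>

definition close_rows :: "nat \<Rightarrow> (nat \<Rightarrow> int) \<Rightarrow> (nat \<Rightarrow> int) \<Rightarrow> bool" where
  "close_rows i r s \<longleftrightarrow> (\<forall>j\<le>i. s j - r j \<in> {0, 1})"

text \<open>With row \<open>i + 1\<close> equal to \<open>r\<close>, interlacing confines each entry
  of row \<open>i\<close> to an interval of its own, so the possible rows form a box.\<close>

definition rows_above :: "nat \<Rightarrow> (nat \<Rightarrow> int) \<Rightarrow> (nat \<Rightarrow> int) set" where
  "rows_above i r = PiE_dflt {..i} 0 (\<lambda>j. {r j..<r (Suc j)})"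

lemma finite_rows_above: "finite (rows_above i r)"
  unfolding rows_above_def by (intro finite_PiE_dflt) auto

text \<open>Both conditions on \<open>p\<close> act entrywise, so the count is a product. The
  candidates for \<open>p j\<close> are \<open>q j - 1\<close> and \<open>q j\<close>; the interval
  from \<open>r j\<close> to \<open>r (Suc j)\<close> removes the first exactly when
  \<open>q j = r j\<close> and the second exactly when \<open>q j = r (Suc j)\<close>.\<close>

lemma card_close_rows_above:
  assumes h: "\<And>j. j \<le> i \<Longrightarrow> s j \<le> q j \<and> q j < s (Suc j)"
    and r: "\<And>j. j \<le> i \<Longrightarrow> r j < r (Suc j)"
    and c: "close_rows (Suc i) r s"
  shows "card {p \<in> rows_above i r. close_rows i p q} =
    (\<Prod>j\<le>i. if r j = q j \<or> r (Suc j) = q j then 1 else 2)"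
proof -
  let ?C = "\<lambda>j. {p. r j \<le> p \<and> p < r (Suc j) \<and> q j - p \<in> {0, 1}}"
  have eq: "{p \<in> rows_above i r. close_rows i p q} = PiE_dflt {..i} 0 ?C"
    unfolding rows_above_def close_rows_def PiE_dflt_def by fastforce
  have card: "card (?C j) = (if r j = q j \<or> r (Suc j) = q j then 1 else 2)" if j: "j \<le> i" for j
  proof -
    have "s j - r j \<in> {0, 1}" "s (Suc j) - r (Suc j) \<in> {0, 1}"
      using c j by (auto simp: close_rows_def)
    \<comment> \<open>Interlacing of \<open>s\<close> with \<open>q\<close> and closeness of
      \<open>r\<close> to \<open>s\<close> place \<open>q j\<close> between \<open>r j\<close> and
      \<open>r (Suc j)\<close>, both ends included.\<close>
    then have b: "r j \<le> q j" "q j \<le> r (Suc j)" "r j < r (Suc j)" using h[OF j] r[OF j] by auto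
    have "?C j = (if r j = q j then {q j} else if r (Suc j) = q j then {q j - 1} else {q j - 1, q j})"
      using b by auto
    then show ?thesis using b by auto
  qed
  have "finite (?C j)" for j by (rule finite_subset[of _ "{r j..<r (Suc j)}"]) auto
  then show ?thesis unfolding eq by (subst card_PiE_dflt) (use card in \<open>auto intro!: prod.cong\<close>)
qed

lemma row_weight_zero:
  assumes "\<not> close_rows i r (h i)"
    and h: "\<And>j. j < i \<Longrightarrow> h i j \<le> h (i - 1) j \<and> h (i - 1) j < h i (Suc j)"
  shows "row_weight h i r = 0"
proof -
  obtain j where j: "j \<le> i" "h i j - r j \<notin> {0, 1}" using assms(1) by (auto simp: close_rows_def)
  have "measure_pmf.prob coin {c. entry i (h (i - 1)) r j c = h i j} = 0"
    unfolding prob_entry using j by auto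
  then show ?thesis using j(1) by (auto simp: row_weight_def)
qed

text \<open>Forcing an entry doubles its probability and excludes exactly one of the two choices for the
  adjacent entry of the previous row, so the two effects cancel.\<close>

lemma card_close_rows_above_times_row_weight:
  assumes h: "\<And>j. j \<le> i \<Longrightarrow> h (Suc i) j \<le> h i j \<and> h i j < h (Suc i) (Suc j)"
    and r: "\<And>j. j \<le> i \<Longrightarrow> r j < r (Suc j)"
  shows "real (card {p \<in> rows_above i r. close_rows i p (h i)}) * row_weight h (Suc i) r
    = of_bool (close_rows (Suc i) r (h (Suc i))) / 2"
proof (cases "close_rows (Suc i) r (h (Suc i))")
  case False
  then have "row_weight h (Suc i) r = 0" using h by (intro row_weight_zero) auto
  then show ?thesis using False by simp
next
  case True
  \<comment> \<open>\<open>L j = 2\<close> marks that \<open>h i j\<close> forces entry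
    \<open>j\<close> of the next row to stay, \<open>R j = 2\<close> that it forces entry
    \<open>j + 1\<close> to grow by one.\<close>
  define L where "L j = (if r j = h i j then 2 else 1 :: real)" for j
  define R where "R j = (if r (Suc j) = h i j then 2 else 1 :: real)" for j
  have close: "h (Suc i) j - r j \<in> {0, 1}" if "j \<le> Suc i" for j
    using True that by (auto simp: close_rows_def)
  have "card {p \<in> rows_above i r. close_rows i p (h i)} =
      (\<Prod>j\<le>i. if r j = h i j \<or> r (Suc j) = h i j then 1 else 2)"
    by (rule card_close_rows_above[OF h r True])
  \<comment> \<open>Since \<open>r j < r (Suc j)\<close>, at most one of \<open>L j\<close> and
    \<open>R j\<close> is 2.\<close>
  also have "real \<dots> = (\<Prod>j\<le>i. 2 / (L j * R j))"
    unfolding of_nat_prod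
  proof (intro prod.cong refl)
    fix j assume "j \<in> {..i}"
    then show "real (if r j = h i j \<or> r (Suc j) = h i j then 1 else 2) = 2 / (L j * R j)"
      using r[of j] by (auto simp: L_def R_def)
  qed
  finally have card: "real (card {p \<in> rows_above i r. close_rows i p (h i)})
      = (\<Prod>j\<le>i. 2 / (L j * R j))" .
  \<comment> \<open>A free entry has probability 1/2 and a forced one 1, because interlacing and
    closeness make the forced value agree with \<open>h (Suc i) j\<close>. Entry \<open>0\<close>
    has no left parent, entry \<open>Suc i\<close> no right parent, and strict growth of
    \<open>h i\<close> prevents two forcings at once.\<close>
  have "measure_pmf.prob coin {c. entry (Suc i) (h i) r j c = h (Suc i) j}
      = 1 / 2 * (if j \<le> i then L j else 1) * (if j = 0 then 1 else R (j - 1))"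
    if j: "j \<le> Suc i" for j
  proof (cases j)
    case 0
    then show ?thesis using close[OF j] h[of 0] unfolding prob_entry
      by (auto simp: L_def)
  next
    case (Suc k)
    have "h i k < h i (Suc k)" if "Suc k \<le> i"
      using h[of k] h[of "Suc k"] that by simp
    then show ?thesis using close[OF j] h[of k] h[of j] Suc j unfolding prob_entry
      by (auto simp: L_def R_def)
  qed
  then have "row_weight h (Suc i) r = (\<Prod>j\<le>Suc i. 1 / 2 * (if j \<le> i then L j else 1)
      * (if j = 0 then 1 else R (j - 1)))"
    unfolding row_weight_def by (intro prod.cong) auto
  also have "\<dots> = (\<Prod>j\<le>Suc i. 1 / 2) * (\<Prod>j\<le>Suc i. if j \<le> i then L j else 1)
      * (\<Prod>j\<le>Suc i. if j = 0 then 1 else R (j - 1))"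
    by (simp only: prod.distrib)
  also have "(\<Prod>j\<le>Suc i. if j \<le> i then L j else 1) = (\<Prod>j\<le>i. L j)"
    by simp
  also have "(\<Prod>j\<le>Suc i. if j = 0 then 1 else R (j - 1)) = (\<Prod>j\<le>i. R j)"
    by (subst prod.atMost_Suc_shift) simp
  also have "(\<Prod>j\<le>Suc i. 1 / 2 :: real) = (\<Prod>j\<le>i. 1 / 2) / 2" by simp
  finally have "real (card {p \<in> rows_above i r. close_rows i p (h i)}) * row_weight h (Suc i) r
    = (\<Prod>j\<le>i. 2 / (L j * R j) * (1 / 2) * L j * R j) / 2"
    unfolding card by (simp only: prod.distrib)
  also have "(\<Prod>j\<le>i. 2 / (L j * R j) * (1 / 2) * L j * R j) = 1"
    by (intro prod.neutral) (auto simp: L_def R_def)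
  finally show ?thesis using True by simp
qed

section \<open>Induction over the rows of the input\<close>

text \<open>Allowing an arbitrary bottom row \<open>r\<close> lets the induction remove one row at a
  time.\<close>

definition arrays_over :: "nat \<Rightarrow> (nat \<Rightarrow> int) \<Rightarrow> tableau set" where
  "arrays_over n r = {g. (\<forall>i j. \<not> (j \<le> i \<and> i \<le> n) \<longrightarrow> g i j = 0) \<and> g n = r \<and>
     (\<forall>i\<in>{1..n}. \<forall>j\<le>i - 1. g i j \<le> g (i - 1) j \<and> g (i - 1) j < g i (j + 1))}"

lemma ST_eq_arrays_over: "ST n = arrays_over n (\<lambda>j. if j \<le> n then 2 * int j + 1 else 0)"
  unfolding ST_def arrays_over_def by (auto simp: fun_eq_iff)

lemma arrays_over_0: "(\<And>j. j > 0 \<Longrightarrow> r j = 0) \<Longrightarrow> arrays_over 0 r = {(\<lambda>_ _. 0)(0 := r)}"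
  unfolding arrays_over_def by (auto simp: fun_eq_iff)

text \<open>An array is its last-but-one row \<open>p\<close> together with an array over
  \<open>p\<close>. The inverse resets row \<open>Suc n\<close> to zero to respect the vanishing
  convention outside the triangle.\<close>

lemma bij_betw_arrays_over_Suc:
  assumes r: "\<And>j. j > Suc n \<Longrightarrow> r j = 0"
  shows "bij_betw (\<lambda>(p, g). g(Suc n := r)) (SIGMA p:rows_above n r. arrays_over n p)
    (arrays_over (Suc n) r)"
proof (rule bij_betw_byWitness[where f' = "\<lambda>g. (g n, g(Suc n := (\<lambda>_. 0)))"])
  show "\<forall>a\<in>SIGMA p:rows_above n r. arrays_over n p.
      (case case a of (p, g) \<Rightarrow> g(Suc n := r) of g \<Rightarrow> (g n, g(Suc n := (\<lambda>_. 0)))) = a"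
    by (auto simp: arrays_over_def fun_eq_iff)
  show "\<forall>g\<in>arrays_over (Suc n) r. (case (g n, g(Suc n := (\<lambda>_. 0))) of (p, g) \<Rightarrow> g(Suc n := r)) = g"
    by (auto simp: arrays_over_def fun_eq_iff)
  show "(\<lambda>(p, g). g(Suc n := r)) ` (SIGMA p:rows_above n r. arrays_over n p)
      \<subseteq> arrays_over (Suc n) r"
  proof clarify
    fix p g assume p: "p \<in> rows_above n r" and g: "g \<in> arrays_over n p"
    have "(g(Suc n := r)) i j \<le> (g(Suc n := r)) (i - 1) j \<and>
        (g(Suc n := r)) (i - 1) j < (g(Suc n := r)) i (j + 1)"
      if i: "i \<in> {1..Suc n}" and j: "j \<le> i - 1" for i j
    proof (cases "i = Suc n")
      case True
      then show ?thesis using p g j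
        by (auto simp: arrays_over_def rows_above_def PiE_dflt_def)
    next
      case False
      then show ?thesis using g i j by (auto simp: arrays_over_def)
    qed
    moreover have "(g(Suc n := r)) i j = 0" if "\<not> (j \<le> i \<and> i \<le> Suc n)" for i j
      using that g r by (auto simp: arrays_over_def)
    ultimately show "g(Suc n := r) \<in> arrays_over (Suc n) r"
      unfolding arrays_over_def by auto
  qed
  show "(\<lambda>g. (g n, g(Suc n := (\<lambda>_. 0)))) ` arrays_over (Suc n) r
      \<subseteq> (SIGMA p:rows_above n r. arrays_over n p)"
  proof clarify
    fix g assume g: "g \<in> arrays_over (Suc n) r"
    have "g n \<in> rows_above n r"
      using g by (auto simp: arrays_over_def rows_above_def PiE_dflt_def
          dest!: bspec[of _ _ "Suc n"])
    moreover have "g(Suc n := (\<lambda>_. 0)) \<in> arrays_over n (g n)"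
      using g by (auto simp: arrays_over_def)
    ultimately show "g n \<in> rows_above n r \<and> g(Suc n := (\<lambda>_. 0)) \<in> arrays_over n (g n)" ..
  qed
qed

lemma finite_arrays_over:
  "(\<And>j. j > n \<Longrightarrow> r j = 0) \<Longrightarrow> finite (arrays_over n r)"
proof (induction n arbitrary: r)
  case 0
  then show ?case by (simp add: arrays_over_0)
next
  case (Suc n)
  have "finite (SIGMA p:rows_above n r. arrays_over n p)"
    using finite_rows_above by (intro finite_SigmaI Suc.IH) (auto simp: rows_above_def PiE_dflt_def)
  then show ?case using bij_betw_finite[OF bij_betw_arrays_over_Suc[of n r]] Suc.prems by simp
qed

lemma finite_ST: "finite (ST n)"
  unfolding ST_eq_arrays_over by (intro finite_arrays_over) simp

text \<open>Induction on \<open>n\<close>, grouping by the last-but-one row \<open>p\<close>: the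
  part above contributes the same amount for every \<open>p\<close> close to \<open>h n\<close> and
  nothing otherwise. What remains is a count of close rows times the weight of the bottom
  row.\<close>

lemma sum_row_weights:
  assumes "\<And>j. j > n \<Longrightarrow> r j = 0"
    and "\<And>j. j < n \<Longrightarrow> r j < r (Suc j)"
    and "\<And>i j. i < n \<Longrightarrow> j \<le> i \<Longrightarrow> h (Suc i) j \<le> h i j \<and> h i j < h (Suc i) (Suc j)"
  shows "(\<Sum>g\<in>arrays_over n r. \<Prod>i\<le>n. row_weight h i (g i))
    = of_bool (close_rows n r (h n)) / 2 ^ Suc n"
  using assms
proof (induction n arbitrary: r)
  case 0
  show ?case unfolding arrays_over_0[of r, OF 0(1), simplified]
    by (simp add: row_weight_def close_rows_def prob_entry)
next
  case (Suc n)
  have IH: "(\<Sum>g\<in>arrays_over n p. \<Prod>i\<le>n. row_weight h i (g i))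
      = of_bool (close_rows n p (h n)) / 2 ^ Suc n"
    if p: "p \<in> rows_above n r" for p
  proof (rule Suc.IH)
    show "p j = 0" if "j > n" for j using p that by (auto simp: rows_above_def PiE_dflt_def)
    show "p j < p (Suc j)" if "j < n" for j
    proof -
      have "p j < r (Suc j)" "r (Suc j) \<le> p (Suc j)"
        using p that by (auto simp: rows_above_def PiE_dflt_def)
      then show ?thesis by simp
    qed
  qed (use Suc.prems(3) in auto)
  have fin: "finite (arrays_over n p)" if "p \<in> rows_above n r" for p
    using that by (intro finite_arrays_over) (auto simp: rows_above_def PiE_dflt_def)
  have "(\<Sum>g\<in>arrays_over (Suc n) r. \<Prod>i\<le>Suc n. row_weight h i (g i))
    = (\<Sum>(p, g)\<in>(SIGMA p:rows_above n r. arrays_over n p).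
        \<Prod>i\<le>Suc n. row_weight h i ((g(Suc n := r)) i))"
    by (subst sum.reindex_bij_betw[OF bij_betw_arrays_over_Suc, symmetric])
       (use Suc.prems in \<open>auto simp: case_prod_unfold\<close>)
  also have "\<dots> = (\<Sum>p\<in>rows_above n r. \<Sum>g\<in>arrays_over n p.
        \<Prod>i\<le>Suc n. row_weight h i ((g(Suc n := r)) i))"
    using finite_rows_above fin by (subst sum.Sigma) auto
  also have "\<dots> = (\<Sum>p\<in>rows_above n r. \<Sum>g\<in>arrays_over n p.
        (\<Prod>i\<le>n. row_weight h i (g i)) * row_weight h (Suc n) r)"
  proof (intro sum.cong refl)
    fix g
    have "(\<Prod>i\<le>n. row_weight h i ((g(Suc n := r)) i)) = (\<Prod>i\<le>n. row_weight h i (g i))"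
      by (intro prod.cong) auto
    then show "(\<Prod>i\<le>Suc n. row_weight h i ((g(Suc n := r)) i))
      = (\<Prod>i\<le>n. row_weight h i (g i)) * row_weight h (Suc n) r" by simp
  qed
  also have "\<dots> = (\<Sum>p\<in>rows_above n r.
      of_bool (close_rows n p (h n)) / 2 ^ Suc n * row_weight h (Suc n) r)"
    by (intro sum.cong refl) (simp only: IH sum_distrib_right[symmetric])
  also have "\<dots> = (\<Sum>p\<in>rows_above n r. of_bool (close_rows n p (h n)))
      * row_weight h (Suc n) r / 2 ^ Suc n"
    by (simp add: sum_distrib_right sum_divide_distrib)
  also have "(\<Sum>p\<in>rows_above n r. of_bool (close_rows n p (h n)) :: real)
      = real (card {p \<in> rows_above n r. close_rows n p (h n)})"
    using finite_rows_above by (simp add: sum.If_cases of_bool_def Int_def)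
  finally show ?case
    using card_close_rows_above_times_row_weight[of n h r] Suc.prems by simp
qed

section \<open>Incoming probability and the size of \<open>ST\<close>\<close>

text \<open>The bottom row of \<open>h\<close> squeezes \<open>h n j\<close> between
  \<open>2 * j + 1\<close> and \<open>2 * j + 2\<close>, so the fixed bottom row of every input is
  close to \<open>h n\<close>.\<close>

lemma sum_prob_shuffle:
  assumes h: "h \<in> ST (n + 1)"
  shows "(\<Sum>g\<in>ST n. measure_pmf.prob (coins n) {\<xi>. shuffle n g \<xi> = h}) = 1 / 2 ^ Suc n"
proof -
  have int: "h (Suc i) j \<le> h i j \<and> h i j < h (Suc i) (Suc j)" if "i \<le> n" "j \<le> i" for i j
    using h that by (auto simp: ST_def dest!: bspec[of _ _ "Suc i"])
  have bot: "h (Suc n) j = 2 * int j + 1" if "j \<le> Suc n" for j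
    using h that by (auto simp: ST_def)
  have "close_rows n (\<lambda>j. if j \<le> n then 2 * int j + 1 else 0) (h n)"
    unfolding close_rows_def
  proof (intro allI impI)
    fix j assume "j \<le> n"
    then show "h n j - (if j \<le> n then 2 * int j + 1 else 0) \<in> {0, 1}"
      using int[of n j] bot[of j] bot[of "Suc j"] by auto
  qed
  then show ?thesis
    unfolding prob_shuffle[OF h] ST_eq_arrays_over by (subst sum_row_weights) (use int in auto)
qed

text \<open>Double counting of transition mass: each input emits mass 1 and each output receives the
  same amount, which yields the ratio of the cardinalities without enumerating tableaux.\<close>

lemma card_ST_Suc: "real (card (ST (n + 1))) = 2 ^ Suc n * real (card (ST n))"
proof -
  have 1: "(\<Sum>h\<in>ST (n + 1). measure_pmf.prob (coins n) {\<xi>. shuffle n g \<xi> = h}) = 1"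
    if g: "g \<in> ST n" for g
  proof -
    have "shuffle n g \<xi> \<in> ST (n + 1)" if "\<xi> \<in> set_pmf (coins n)" for \<xi>
    proof (rule shuffle_in_ST[OF g])
      have "finite {(i, j). j \<le> i \<and> i \<le> n}"
        by (rule finite_subset[of _ "{..n} \<times> {..n}"]) auto
      \<comment> \<open>The default 0 is itself a coin value, so in the support every coordinate is
        0 or 1, also outside the index triangle, as \<open>shuffle_in_ST\<close> demands.\<close>
      then have "\<xi> \<in> PiE_dflt {(i, j). j \<le> i \<and> i \<le> n} 0 (\<lambda>_. {0, 1})"
        using that unfolding coins_def by (subst (asm) set_Pi_pmf) (auto simp: o_def)
      then show "\<xi> p \<in> {0, 1}" for p unfolding PiE_dflt_def by (cases p) force
    qed
    then have "(\<Sum>h\<in>ST (n + 1). pmf (map_pmf (shuffle n g) (coins n)) h) = 1"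
      by (intro sum_pmf_eq_1 finite_ST) auto
    then show ?thesis by (simp add: pmf_map vimage_def)
  qed
  have "real (card (ST n))
      = (\<Sum>g\<in>ST n. \<Sum>h\<in>ST (n + 1). measure_pmf.prob (coins n) {\<xi>. shuffle n g \<xi> = h})"
    by (simp add: 1[simplified])
  also have "\<dots> = (\<Sum>h\<in>ST (n + 1). \<Sum>g\<in>ST n. measure_pmf.prob (coins n) {\<xi>. shuffle n g \<xi> = h})"
    by (rule sum.swap)
  also have "\<dots> = real (card (ST (n + 1))) / 2 ^ Suc n"
    by (simp add: sum_prob_shuffle[simplified])
  finally show ?thesis by (simp add: field_simps)
qed

section \<open>Coordinates in the triangular lattice\<close>

definition lat :: "real \<Rightarrow> real \<Rightarrow> complex" where
  "lat x y = of_real x * lat_v + of_real y * lat_w"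

definition pt :: "int \<Rightarrow> int \<Rightarrow> complex" where
  "pt a b = lat (of_int a) (of_int b)"

lemma Re_lat: "Re (lat x y) = x + y / 2" and Im_lat: "Im (lat x y) = sqrt 3 / 2 * y"
  by (simp_all add: lat_def lat_v_def lat_w_def)

lemma lat_eq_iff [simp]: "lat x y = lat x' y' \<longleftrightarrow> x = x' \<and> y = y'"
  by (auto simp: complex_eq_iff Re_lat Im_lat)

lemma pt_eq_iff [simp]: "pt a b = pt a' b' \<longleftrightarrow> a = a' \<and> b = b'"
  by (simp add: pt_def)

lemma lat_add: "lat x y + lat x' y' = lat (x + x') (y + y')"
  by (simp add: complex_eq_iff Re_lat Im_lat algebra_simps add_divide_distrib)

lemma lat_scaleR: "c *\<^sub>R lat x y = lat (c * x) (c * y)"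
  by (simp add: complex_eq_iff Re_lat Im_lat algebra_simps)

lemma lat_divide: "lat x y / of_real c = lat (x / c) (y / c)"
  by (simp add: complex_eq_iff Re_lat Im_lat add_divide_distrib)

lemma tri_lattice_eq: "tri_lattice = {pt a b | a b. True}"
  by (simp add: tri_lattice_def pt_def lat_def)

text \<open>This is the norm form of the Eisenstein integers, whose units are the six unit steps of
  the lattice. Completing the square bounds each coordinate by 1 in absolute value.\<close>

lemma eisenstein_unit:
  fixes x y :: int
  assumes "x\<^sup>2 + x * y + y\<^sup>2 = 1"
  shows "(x, y) \<in> {(1, 0), (-1, 0), (0, 1), (0, -1), (1, -1), (-1, 1)}"
proof -
  have bound: "\<bar>t\<bar> \<le> 1" if "s\<^sup>2 + s * t + t\<^sup>2 = 1" for s t :: int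
  proof (rule ccontr)
    assume "\<not> \<bar>t\<bar> \<le> 1"
    then have "2\<^sup>2 \<le> \<bar>t\<bar>\<^sup>2" by (intro power_mono) auto
    moreover have "(2 * s + t)\<^sup>2 + 3 * t\<^sup>2 = 4"
      using that by (simp add: power2_eq_square algebra_simps)
    ultimately show False using zero_le_power2[of "2 * s + t"] by simp
  qed
  have "\<bar>x\<bar> \<le> 1" "\<bar>y\<bar> \<le> 1"
    using bound[of x y] bound[of y x] assms by (simp_all add: algebra_simps)
  then have "x \<in> {-1, 0, 1}" "y \<in> {-1, 0, 1}" by auto
  then show ?thesis using assms by auto
qed

lemma dist_pt:
  "(dist (pt a b) (pt c d))\<^sup>2 = of_int ((a - c)\<^sup>2 + (a - c) * (b - d) + (b - d)\<^sup>2)"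
proof -
  have "(dist (pt a b) (pt c d))\<^sup>2
      = (of_int a + of_int b / 2 - of_int c - of_int d / 2)\<^sup>2 + (sqrt 3 / 2 * (of_int b - of_int d))\<^sup>2"
    by (simp add: dist_norm norm_complex_def pt_def Re_lat Im_lat algebra_simps diff_divide_distrib)
  also have "\<dots> = of_int ((a - c)\<^sup>2 + (a - c) * (b - d) + (b - d)\<^sup>2)"
    by (simp add: power_mult_distrib power_divide) (simp add: power2_eq_square field_simps)
  finally show ?thesis .
qed

lemma dist_pt_1:
  "dist (pt a b) (pt c d) = 1 \<longleftrightarrow>
    (c - a, d - b) \<in> {(1, 0), (-1, 0), (0, 1), (0, -1), (1, -1), (-1, 1)}"
proof -
  have "dist (pt a b) (pt c d) = 1 \<longleftrightarrow> (dist (pt a b) (pt c d))\<^sup>2 = 1"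
    by (simp add: power2_eq_1_iff order.trans[OF _ zero_le_dist] neq_iff)
       (smt (verit) zero_le_dist)
  also have "\<dots> \<longleftrightarrow> (c - a)\<^sup>2 + (c - a) * (d - b) + (d - b)\<^sup>2 = 1"
    unfolding dist_pt of_int_eq_1_iff by (simp add: power2_eq_square algebra_simps)
  also have "\<dots> \<longleftrightarrow> (c - a, d - b) \<in> {(1, 0), (-1, 0), (0, 1), (0, -1), (1, -1), (-1, 1)}"
    using eisenstein_unit[of "c - a" "d - b"] by auto
  finally show ?thesis .
qed

section \<open>Unit triangles and their adjacency\<close>

text \<open>The lattice cell with lower left corner \<open>pt a b\<close> is cut by a diagonal into
  \<open>up a b\<close> and \<open>down a b\<close>.\<close>

definition up :: "int \<Rightarrow> int \<Rightarrow> face" where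
  "up a b = {pt a b, pt (a + 1) b, pt a (b + 1)}"

definition down :: "int \<Rightarrow> int \<Rightarrow> face" where
  "down a b = {pt (a + 1) b, pt a (b + 1), pt (a + 1) (b + 1)}"

text \<open>Two unit steps differing by a unit step enclose an angle of 60 degrees. The twelve
  ordered pairs of this kind span the six triangles around \<open>pt a b\<close>.\<close>

lemma triangle_at:
  assumes "(x, y) \<in> {(1, 0), (-1, 0), (0, 1), (0, -1), (1, -1), (-1, 1 :: int)}"
    and "(x', y') \<in> {(1, 0), (-1, 0), (0, 1), (0, -1), (1, -1), (-1, 1 :: int)}"
    and "(x' - x, y' - y) \<in> {(1, 0), (-1, 0), (0, 1), (0, -1), (1, -1), (-1, 1)}"
  shows "{pt a b, pt (a + x) (b + y), pt (a + x') (b + y')} \<in>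
    {up a b, up (a - 1) b, up a (b - 1), down a (b - 1), down (a - 1) b, down (a - 1) (b - 1)}"
proof -
  have "(x, y, x', y') \<in> {(1, 0, 0, 1), (0, 1, 1, 0), (0, 1, -1, 1), (-1, 1, 0, 1),
      (-1, 1, -1, 0), (-1, 0, -1, 1), (-1, 0, 0, -1), (0, -1, -1, 0),
      (0, -1, 1, -1), (1, -1, 0, -1), (1, -1, 1, 0), (1, 0, 1, -1)}"
    using assms(1,2) unfolding insert_iff empty_iff prod.inject
    by (elim disjE conjE; use assms(3) in simp)
  then show ?thesis
    unfolding insert_iff[of "(x, y, x', y')"] empty_iff prod.inject
    by (elim disjE conjE) (simp_all add: up_def down_def insert_commute)
qed

lemma tri_faces_eq: "tri_faces = {up a b | a b. True} \<union> {down a b | a b. True}"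
proof (intro equalityI subsetI)
  fix F assume F: "F \<in> tri_faces"
  then obtain p q r where pqr: "F = {p, q, r}" "p \<noteq> q" "q \<noteq> r" "p \<noteq> r"
    by (auto simp: tri_faces_def card_3_iff)
  have "p \<in> tri_lattice" "q \<in> tri_lattice" "r \<in> tri_lattice"
    using F pqr(1) by (auto simp: tri_faces_def)
  then obtain a b c d e f where pt: "p = pt a b" "q = pt c d" "r = pt e f"
    unfolding tri_lattice_eq by blast
  have "dist p q = 1" "dist p r = 1" "dist q r = 1"
    using F pqr by (auto simp: tri_faces_def)
  then have "{pt a b, pt (a + (c - a)) (b + (d - b)), pt (a + (e - a)) (b + (f - b))} \<in>
    {up a b, up (a - 1) b, up a (b - 1), down a (b - 1), down (a - 1) b, down (a - 1) (b - 1)}"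
    unfolding pt dist_pt_1 by (intro triangle_at) (simp_all only: diff_diff_eq2 diff_add_cancel)
  then show "F \<in> {up a b | a b. True} \<union> {down a b | a b. True}"
    unfolding pqr(1) pt by (simp only: add_diff_cancel_left' add_diff_inverse add_diff_eq insert_iff) auto
next
  fix F assume "F \<in> {up a b | a b. True} \<union> {down a b | a b. True}"
  then show "F \<in> tri_faces"
    by (auto simp: tri_faces_def tri_lattice_eq up_def down_def dist_pt_1)
qed

lemma face_centre_up: "face_centre (up a b) = lat (of_int a + 1 / 3) (of_int b + 1 / 3)"
proof -
  have "(\<Sum>p\<in>up a b. p) = lat (3 * of_int a + 1) (3 * of_int b + 1)"
    by (simp add: up_def) (simp add: pt_def lat_add)
  then have "face_centre (up a b) = lat ((3 * of_int a + 1) / 3) ((3 * of_int b + 1) / 3)"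
    using lat_divide[of "3 * of_int a + 1" "3 * of_int b + 1" 3] by (simp add: face_centre_def)
  then show ?thesis by (simp add: add_divide_distrib)
qed

lemma face_centre_down: "face_centre (down a b) = lat (of_int a + 2 / 3) (of_int b + 2 / 3)"
proof -
  have "(\<Sum>p\<in>down a b. p) = lat (3 * of_int a + 2) (3 * of_int b + 2)"
    by (simp add: down_def) (simp add: pt_def lat_add)
  then have "face_centre (down a b) = lat ((3 * of_int a + 2) / 3) ((3 * of_int b + 2) / 3)"
    using lat_divide[of "3 * of_int a + 2" "3 * of_int b + 2" 3] by (simp add: face_centre_def)
  then show ?thesis by (simp add: add_divide_distrib)
qed

lemma up_eq_iff [simp]: "up a b = up c d \<longleftrightarrow> a = c \<and> b = d"
  by (metis face_centre_up lat_eq_iff add_right_cancel of_int_eq_iff)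

lemma down_eq_iff [simp]: "down a b = down c d \<longleftrightarrow> a = c \<and> b = d"
  by (metis face_centre_down lat_eq_iff add_right_cancel of_int_eq_iff)

lemma up_neq_down [simp]: "up a b \<noteq> down c d" "down c d \<noteq> up a b"
proof -
  have "real_of_int a + 1 / 3 \<noteq> of_int c + 2 / 3"
  proof
    assume "real_of_int a + 1 / 3 = of_int c + 2 / 3"
    then have "real_of_int (3 * (a - c)) = of_int 1" by simp
    then have "3 * (a - c) = 1" unfolding of_int_eq_iff .
    then show False by presburger
  qed
  then show "up a b \<noteq> down c d" by (metis face_centre_up face_centre_down lat_eq_iff)
  then show "down c d \<noteq> up a b" by simp
qed

lemma card_inter_eq_2D:
  assumes "card (A \<inter> B) = 2"
  obtains p q where "p \<noteq> q" "p \<in> A" "q \<in> A" "p \<in> B" "q \<in> B"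
  using assms by (auto simp: card_2_iff)

text \<open>Any two corners determine the cell by their coordinatewise minimum, so distinct upward
  triangles cannot share a side. For downward triangles the maximum takes this role.\<close>

lemma corner_of_up:
  assumes "pt s t \<noteq> pt u v" "pt s t \<in> up a b" "pt u v \<in> up a b"
  shows "a = min s u \<and> b = min t v"
  using assms unfolding up_def insert_iff empty_iff pt_eq_iff simp_thms
  by (elim disjE conjE) simp_all

lemma up_inter_up: "card (up a b \<inter> up c d) = 2 \<longleftrightarrow> False"
proof
  assume *: "card (up a b \<inter> up c d) = 2"
  obtain p q where pq: "p \<noteq> q" "p \<in> up a b" "q \<in> up a b" "p \<in> up c d" "q \<in> up c d"
    by (rule card_inter_eq_2D[OF *])
  moreover obtain s t u v where "p = pt s t" "q = pt u v"
    using pq(2,3) unfolding up_def by blast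
  ultimately have "a = c \<and> b = d"
    using corner_of_up[of s t u v a b] corner_of_up[of s t u v c d] by simp
  with * show False by (simp add: up_def)
qed simp

lemma corner_of_down:
  assumes "pt s t \<noteq> pt u v" "pt s t \<in> down a b" "pt u v \<in> down a b"
  shows "a + 1 = max s u \<and> b + 1 = max t v"
  using assms unfolding down_def insert_iff empty_iff pt_eq_iff simp_thms
  by (elim disjE conjE) simp_all

lemma down_inter_down: "card (down a b \<inter> down c d) = 2 \<longleftrightarrow> False"
proof
  assume *: "card (down a b \<inter> down c d) = 2"
  obtain p q where pq: "p \<noteq> q" "p \<in> down a b" "q \<in> down a b" "p \<in> down c d" "q \<in> down c d"
    by (rule card_inter_eq_2D[OF *])
  moreover obtain s t u v where "p = pt s t" "q = pt u v"
    using pq(2,3) unfolding down_def by blast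
  ultimately have "a = c \<and> b = d"
    using corner_of_down[of s t u v a b] corner_of_down[of s t u v c d] by simp
  with * show False by (simp add: down_def)
qed simp

lemma up_inter_down:
  "card (up a b \<inter> down c d) = 2 \<longleftrightarrow> (c, d) \<in> {(a, b), (a - 1, b), (a, b - 1)}"
proof
  assume "card (up a b \<inter> down c d) = 2"
  then show "(c, d) \<in> {(a, b), (a - 1, b), (a, b - 1)}"
    by (elim card_inter_eq_2D) (auto simp: up_def down_def)
next
  assume "(c, d) \<in> {(a, b), (a - 1, b), (a, b - 1)}"
  then show "card (up a b \<inter> down c d) = 2"
    by (auto simp: up_def down_def)
qed

section \<open>Trapezoids as systems of linear inequalities\<close>

lemma convex_hull_halfspace:
  fixes f :: "complex \<Rightarrow> real"
  assumes "linear f" "\<And>p. p \<in> S \<Longrightarrow> f p \<le> c" "z \<in> convex hull S"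
  shows "f z \<le> c"
proof -
  have "convex (f -` {..c})" using assms(1) by (intro convex_linear_vimage) auto
  then have "convex hull S \<subseteq> f -` {..c}" using assms(2) by (intro hull_minimal) auto
  then show ?thesis using assms(3) by auto
qed

lemma segment_mem_hull:
  assumes "lat x0 y \<in> convex hull S" "lat x1 y \<in> convex hull S" "x0 \<le> x" "x \<le> x1"
  shows "lat x y \<in> convex hull S"
proof (cases "x0 = x1")
  case True
  then show ?thesis using assms by auto
next
  case False
  define t where "t = (x - x0) / (x1 - x0)"
  have t: "0 \<le> t" "t \<le> 1" using assms False by (auto simp: t_def)
  have "(1 - t) *\<^sub>R lat x0 y + t *\<^sub>R lat x1 y \<in> convex hull S"
    using t assms by (intro convexD) (auto simp: convex_convex_hull)
  also have "(1 - t) *\<^sub>R lat x0 y + t *\<^sub>R lat x1 y = lat x y"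
  proof -
    have "t * (x1 - x0) = x - x0" using False by (simp add: t_def)
    then show ?thesis by (simp add: lat_scaleR lat_add algebra_simps)
  qed
  finally show ?thesis .
qed

lemma vertices_segment_mem_hull:
  assumes "lat x0 y0 \<in> S" "lat x1 y1 \<in> S" "0 \<le> t" "t \<le> 1"
  shows "lat ((1 - t) * x0 + t * x1) ((1 - t) * y0 + t * y1) \<in> convex hull S"
proof -
  have "(1 - t) *\<^sub>R lat x0 y0 + t *\<^sub>R lat x1 y1 \<in> convex hull S"
    using assms by (intro convexD) (auto simp: convex_convex_hull hull_inc)
  then show ?thesis by (simp add: lat_scaleR lat_add)
qed

definition xcoord :: "complex \<Rightarrow> real" where "xcoord z = Re z - Im z / sqrt 3"
definition ycoord :: "complex \<Rightarrow> real" where "ycoord z = 2 * Im z / sqrt 3"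

lemma coords_lat [simp]: "xcoord (lat x y) = x" "ycoord (lat x y) = y"
  by (simp_all add: xcoord_def ycoord_def Re_lat Im_lat)

lemma linear_coords: "linear (\<lambda>z. \<alpha> * xcoord z + \<beta> * ycoord z)"
  by (intro linearI) (simp_all add: xcoord_def ycoord_def algebra_simps add_divide_distrib)

lemma convex_hull_lat_halfspace:
  assumes "lat x y \<in> convex hull S" "\<forall>p\<in>S. \<alpha> * xcoord p + \<beta> * ycoord p \<le> c"
  shows "\<alpha> * x + \<beta> * y \<le> c"
  using convex_hull_halfspace[of "\<lambda>z. \<alpha> * xcoord z + \<beta> * ycoord z" S c "lat x y"] assms linear_coords
  by simp

text \<open>Four half-planes give one direction. Conversely, the horizontal line through the point
  meets the left and right sides in points of the hull, and the point lies between them.\<close>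

lemma upper_trapezoid:
  fixes m :: real
  assumes "m > 0"
  shows "lat x y \<in> convex hull {lat m 0, lat 0 m, lat (-m) m, lat (-m) 0} \<longleftrightarrow>
    0 \<le> y \<and> y \<le> m \<and> -m \<le> x \<and> x + y \<le> m" (is "_ \<in> convex hull ?S \<longleftrightarrow> ?R")
proof
  assume *: "lat x y \<in> convex hull ?S"
  show ?R
    using convex_hull_lat_halfspace[OF *, of 0 "-1" 0] convex_hull_lat_halfspace[OF *, of 0 1 m]
      convex_hull_lat_halfspace[OF *, of "-1" 0 m] convex_hull_lat_halfspace[OF *, of 1 1 m] assms
    by auto
next
  assume R: ?R
  have t: "0 \<le> y / m" "y / m \<le> 1" "y / m * m = y" using R assms by auto
  have "lat (-m) y \<in> convex hull ?S"
    using vertices_segment_mem_hull[of "-m" 0 ?S "-m" m "y / m"] t by (simp add: algebra_simps)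
  moreover have "lat (m - y) y \<in> convex hull ?S"
    using vertices_segment_mem_hull[of m 0 ?S 0 m "y / m"] t by (simp add: algebra_simps)
  ultimately show "lat x y \<in> convex hull ?S"
    using R by (intro segment_mem_hull[of "-m" y _ "m - y" x]) auto
qed

lemma lower_trapezoid:
  "lat x y \<in> convex hull {lat (c + 1) 0, lat (c - 1) 0, lat c (-1), lat (c + 1) (-1)} \<longleftrightarrow>
    -1 \<le> y \<and> y \<le> 0 \<and> x \<le> c + 1 \<and> c - 1 \<le> x + y" (is "_ \<in> convex hull ?S \<longleftrightarrow> ?R")
proof
  assume *: "lat x y \<in> convex hull ?S"
  show ?R
    using convex_hull_lat_halfspace[OF *, of 0 "-1" 1] convex_hull_lat_halfspace[OF *, of 0 1 0]
      convex_hull_lat_halfspace[OF *, of 1 0 "c + 1"]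
      convex_hull_lat_halfspace[OF *, of "-1" "-1" "1 - c"]
    by auto
next
  assume R: ?R
  have t: "0 \<le> -y" "-y \<le> 1" using R by auto
  have "lat (c - 1 - y) y \<in> convex hull ?S"
    using vertices_segment_mem_hull[of "c - 1" 0 ?S c "-1" "-y"] t by (simp add: algebra_simps)
  moreover have "lat (c + 1) y \<in> convex hull ?S"
    using vertices_segment_mem_hull[of "c + 1" 0 ?S "c + 1" "-1" "-y"] t by (simp add: algebra_simps)
  ultimately show "lat x y \<in> convex hull ?S"
    using R by (intro segment_mem_hull[of "c - 1 - y" y _ "c + 1" x]) auto
qed

lemma lat_mem_hh_region:
  assumes "n > 0"
  shows "lat x y \<in> hh_region n \<longleftrightarrow>
    (0 \<le> y \<and> y \<le> n \<and> - real n \<le> x \<and> x + y \<le> n) \<or>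
    (\<exists>i<n. let c = 2 * real i - n + 1 in -1 \<le> y \<and> y \<le> 0 \<and> x \<le> c + 1 \<and> c - 1 \<le> x + y)"
proof -
  have 1: "{of_nat n * lat_v, of_nat n * lat_w, of_nat n * (lat_w - lat_v), - of_nat n * lat_v}
    = {lat n 0, lat 0 n, lat (- real n) n, lat (- real n) 0}"
    by (simp add: lat_def algebra_simps)
  have 2: "(let c = of_int (2 * int i - int n + 1) * lat_v in
           convex hull {c + lat_v, c - lat_v, c - lat_w, c + lat_v - lat_w}) =
      (let c = 2 * real i - n + 1 in
           convex hull {lat (c + 1) 0, lat (c - 1) 0, lat c (-1), lat (c + 1) (-1)})" for i
    by (simp add: lat_def algebra_simps Let_def)
  show ?thesis
    unfolding hh_region_def 1 2 unfolding Un_iff UN_iff Let_def lower_trapezoid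
    using assms by (subst upper_trapezoid) auto
qed

section \<open>The half-hexagon graph in row coordinates\<close>

text \<open>Centroids have coordinates in thirds of integers; clearing denominators leaves integer
  inequalities that Presburger arithmetic can settle.\<close>

lemma lat_thirds_mem_hh_region:
  assumes "n > 0"
  shows "lat (of_int p / 3) (of_int q / 3) \<in> hh_region n \<longleftrightarrow>
    (0 \<le> q \<and> q \<le> 3 * int n \<and> - 3 * int n \<le> p \<and> p + q \<le> 3 * int n) \<or>
    (\<exists>i<n. -3 \<le> q \<and> q \<le> 0 \<and> p \<le> 3 * (2 * int i - int n + 2) \<and> 3 * (2 * int i - int n) \<le> p + q)"
proof -
  have 1: "0 \<le> real_of_int q / 3 \<and> real_of_int q / 3 \<le> n \<and> - real n \<le> real_of_int p / 3 \<and>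
      real_of_int p / 3 + real_of_int q / 3 \<le> n \<longleftrightarrow>
    real_of_int 0 \<le> of_int q \<and> real_of_int q \<le> of_int (3 * int n) \<and>
      real_of_int (- 3 * int n) \<le> of_int p \<and> real_of_int (p + q) \<le> of_int (3 * int n)"
    by (simp add: field_simps)
  have 2: "-1 \<le> real_of_int q / 3 \<and> real_of_int q / 3 \<le> 0 \<and>
      real_of_int p / 3 \<le> (2 * real i - n + 1) + 1 \<and>
      (2 * real i - n + 1) - 1 \<le> real_of_int p / 3 + real_of_int q / 3 \<longleftrightarrow>
    real_of_int (-3) \<le> of_int q \<and> real_of_int q \<le> of_int 0 \<and>
      real_of_int p \<le> of_int (3 * (2 * int i - int n + 2)) \<and>
      real_of_int (3 * (2 * int i - int n)) \<le> of_int (p + q)" for i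
    by (simp add: field_simps)
  show ?thesis
    unfolding lat_mem_hh_region[OF assms] Let_def 1 2 of_int_le_iff ..
qed

lemma lat_mem_hh_region_0: "lat x y \<in> hh_region 0 \<longleftrightarrow> x = 0 \<and> y = 0"
proof -
  have "hh_region 0 = {lat 0 0}" by (simp add: hh_region_def lat_def)
  then show ?thesis by simp
qed

text \<open>A lower trapezoid contains a single upward triangle between two downward ones, hence the
  gaps in the strip \<open>b = -1\<close>.\<close>

lemma up_mem_hh_vertices:
  "up a b \<in> hh_vertices n \<longleftrightarrow>
    (0 \<le> b \<and> b < int n \<and> - int n \<le> a \<and> a + b < int n) \<or>
    (b = -1 \<and> (\<exists>i<n. a = 2 * int i - int n + 1))"
proof -
  have *: "up a b \<in> hh_vertices n \<longleftrightarrow>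
      lat (of_int (3 * a + 1) / 3) (of_int (3 * b + 1) / 3) \<in> hh_region n"
    by (auto simp: hh_vertices_def tri_faces_eq face_centre_up add_divide_distrib)
  show ?thesis
  proof (cases "n = 0")
    case True
    have "3 * a + 1 \<noteq> 0" by presburger
    then have "real_of_int (3 * a + 1) \<noteq> 0" by (simp only: of_int_eq_0_iff) simp
    then have "up a b \<notin> hh_vertices n" unfolding * unfolding True lat_mem_hh_region_0 by auto
    then show ?thesis using True by auto
  next
    case False
    then have n: "n > 0" by simp
    have "(-3 \<le> 3 * b + 1 \<and> 3 * b + 1 \<le> 0 \<and> 3 * a + 1 \<le> 3 * (2 * int i - int n + 2) \<and>
        3 * (2 * int i - int n) \<le> 3 * a + 1 + (3 * b + 1)) \<longleftrightarrow> b = -1 \<and> a = 2 * int i - int n + 1"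
      for i by presburger
    moreover have "0 \<le> 3 * b + 1 \<and> 3 * b + 1 \<le> 3 * int n \<and> - 3 * int n \<le> 3 * a + 1 \<and>
        3 * a + 1 + (3 * b + 1) \<le> 3 * int n \<longleftrightarrow>
        0 \<le> b \<and> b < int n \<and> - int n \<le> a \<and> a + b < int n" by presburger
    ultimately show ?thesis
      unfolding * lat_thirds_mem_hh_region[OF n] by (simp only:) blast
  qed
qed

lemma down_mem_hh_vertices:
  "down a b \<in> hh_vertices n \<longleftrightarrow>
    (-1 \<le> b \<and> b < int n \<and> - int n \<le> a \<and> a + b + 1 < int n)"
proof -
  have *: "down a b \<in> hh_vertices n \<longleftrightarrow>
      lat (of_int (3 * a + 2) / 3) (of_int (3 * b + 2) / 3) \<in> hh_region n"
    by (auto simp: hh_vertices_def tri_faces_eq face_centre_down add_divide_distrib)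
  show ?thesis
  proof (cases "n = 0")
    case True
    have "3 * a + 2 \<noteq> 0" by presburger
    then have "real_of_int (3 * a + 2) \<noteq> 0" by (simp only: of_int_eq_0_iff) simp
    then have "down a b \<notin> hh_vertices n" unfolding * unfolding True lat_mem_hh_region_0 by auto
    then show ?thesis using True by auto
  next
    case False
    then have n: "n > 0" by simp
    have "(-3 \<le> 3 * b + 2 \<and> 3 * b + 2 \<le> 0 \<and> 3 * a + 2 \<le> 3 * (2 * int i - int n + 2) \<and>
        3 * (2 * int i - int n) \<le> 3 * a + 2 + (3 * b + 2)) \<longleftrightarrow>
        b = -1 \<and> 2 * int i - int n \<le> a \<and> a \<le> 2 * int i - int n + 1"
      for i by presburger
    moreover have "(\<exists>i<n. 2 * int i - int n \<le> a \<and> a \<le> 2 * int i - int n + 1) \<longleftrightarrow>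
        - int n \<le> a \<and> a < int n"
    proof
      assume "- int n \<le> a \<and> a < int n"
      \<comment> \<open>The downward triangles of trapezoid \<open>i\<close> have
        \<open>a = 2 * i - n\<close> or \<open>a = 2 * i - n + 1\<close>, so halving
        \<open>a + n\<close> recovers \<open>i\<close>.\<close>
      then show "\<exists>i<n. 2 * int i - int n \<le> a \<and> a \<le> 2 * int i - int n + 1"
        by (intro exI[of _ "nat ((a + int n) div 2)"]) auto
    qed auto
    moreover have "0 \<le> 3 * b + 2 \<and> 3 * b + 2 \<le> 3 * int n \<and> - 3 * int n \<le> 3 * a + 2 \<and>
        3 * a + 2 + (3 * b + 2) \<le> 3 * int n \<longleftrightarrow>
        0 \<le> b \<and> b < int n \<and> - int n \<le> a \<and> a + b + 1 < int n" by presburger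
    ultimately show ?thesis unfolding * lat_thirds_mem_hh_region[OF n] by auto
  qed
qed

text \<open>\<open>upper n i j\<close> and \<open>lower n i j\<close> are the triangles above and below the edge at position \<open>j\<close> of
  row \<open>i\<close>; thus \<open>lower n k _\<close> and \<open>upper n (k + 1) _\<close> alternate along the strip between the rows
  \<open>k\<close> and \<open>k + 1\<close>.\<close>

definition upper :: "nat \<Rightarrow> nat \<Rightarrow> nat \<Rightarrow> face" where
  "upper n i j = up (int j - int n - 1) (int n - int i)"

definition lower :: "nat \<Rightarrow> nat \<Rightarrow> nat \<Rightarrow> face" where
  "lower n i j = down (int j - int n - 1) (int n - int i - 1)"

lemma upper_lower_eq_iff [simp]:
  "upper n i j = upper n i' j' \<longleftrightarrow> i = i' \<and> j = j'"
  "lower n i j = lower n i' j' \<longleftrightarrow> i = i' \<and> j = j'"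
  "upper n i j \<noteq> lower n i' j'" "lower n i' j' \<noteq> upper n i j"
  by (auto simp: upper_def lower_def)

lemma lower_mem_hh_vertices: "lower n k j \<in> hh_vertices n \<longleftrightarrow> k \<le> n \<and> 1 \<le> j \<and> j \<le> n + k"
  unfolding lower_def down_mem_hh_vertices by auto

lemma upper_mem_hh_vertices:
  "upper n (Suc k) j \<in> hh_vertices n \<longleftrightarrow>
    k \<le> n \<and> 1 \<le> j \<and> j \<le> n + k + 1 \<and> (k = n \<longrightarrow> even j)"
proof -
  have "(\<exists>i<n. int j - int n - 1 = 2 * int i - int n + 1) \<longleftrightarrow> 1 \<le> j \<and> j \<le> 2 * n + 1 \<and> even j"
  proof
    assume "1 \<le> j \<and> j \<le> 2 * n + 1 \<and> even j"
    then show "\<exists>i<n. int j - int n - 1 = 2 * int i - int n + 1"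
      by (intro exI[of _ "j div 2 - 1"]) (auto elim!: evenE)
  qed (auto, presburger+)
  then show ?thesis unfolding upper_def up_mem_hh_vertices by auto
qed

lemma hh_vertices_eq:
  "hh_vertices n = {lower n k j | k j. k \<le> n \<and> 1 \<le> j \<and> j \<le> n + k} \<union>
    {upper n (Suc k) j | k j. k \<le> n \<and> 1 \<le> j \<and> j \<le> n + k + 1 \<and> (k = n \<longrightarrow> even j)}"
    (is "_ = ?L \<union> ?U")
proof (intro equalityI subsetI)
  fix F assume F: "F \<in> hh_vertices n"
  then consider a b where "F = up a b" | a b where "F = down a b"
    by (auto simp: hh_vertices_def tri_faces_eq)
  then show "F \<in> ?L \<union> ?U"
  proof cases
    case 1
    then have "b < int n" "- int n \<le> a" using F by (auto simp: up_mem_hh_vertices)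
    then have "F = upper n (Suc (nat (int n - b - 1))) (nat (a + int n + 1))"
      unfolding 1 upper_def by auto
    then obtain k j where "F = upper n (Suc k) j" by blast
    then show ?thesis using F by (auto simp: upper_mem_hh_vertices)
  next
    case 2
    then have "b < int n" "- int n \<le> a" using F by (auto simp: down_mem_hh_vertices)
    then have "F = lower n (nat (int n - b - 1)) (nat (a + int n + 1))"
      unfolding 2 lower_def by auto
    then obtain k j where "F = lower n k j" by blast
    then show ?thesis using F by (auto simp: lower_mem_hh_vertices)
  qed
qed (auto simp: lower_mem_hh_vertices upper_mem_hh_vertices)

lemma ball_hh_vertices:
  "(\<forall>F\<in>hh_vertices n. P F) \<longleftrightarrow> (\<forall>k\<le>n. (\<forall>j\<in>{1..n + k}. P (lower n k j)) \<and>
    (\<forall>j\<in>{1..n + k + 1}. (k = n \<longrightarrow> even j) \<longrightarrow> P (upper n (Suc k) j)))"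
  unfolding hh_vertices_eq ball_Un by (simp add: Ball_def) blast

section \<open>Edges of the graph\<close>

text \<open>The three edges at \<open>lower n k j\<close>: \<open>vedge\<close> leads to the
  triangle above, \<open>ledge\<close> and \<open>redge\<close> to the left and right neighbours in
  the strip between rows \<open>k\<close> and \<open>k + 1\<close>.\<close>

definition vedge :: "nat \<Rightarrow> nat \<Rightarrow> nat \<Rightarrow> dual_edge" where
  "vedge n k j = {upper n k j, lower n k j}"

definition ledge :: "nat \<Rightarrow> nat \<Rightarrow> nat \<Rightarrow> dual_edge" where
  "ledge n k j = {lower n k j, upper n (Suc k) j}"

definition redge :: "nat \<Rightarrow> nat \<Rightarrow> nat \<Rightarrow> dual_edge" where
  "redge n k j = {lower n k j, upper n (Suc k) (Suc j)}"

lemma edge_eq_iff [simp]: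
  "vedge n k j = vedge n k' j' \<longleftrightarrow> k = k' \<and> j = j'"
  "ledge n k j = ledge n k' j' \<longleftrightarrow> k = k' \<and> j = j'"
  "redge n k j = redge n k' j' \<longleftrightarrow> k = k' \<and> j = j'"
  "vedge n k j \<noteq> ledge n k' j'" "ledge n k' j' \<noteq> vedge n k j"
  "vedge n k j \<noteq> redge n k' j'" "redge n k' j' \<noteq> vedge n k j"
  "ledge n k j \<noteq> redge n k' j'" "redge n k' j' \<noteq> ledge n k j"
  by (auto simp: vedge_def ledge_def redge_def doubleton_eq_iff)

lemma upper_lower_adjacent:
  "card (upper n i j \<inter> lower n k l) = 2 \<longleftrightarrow>
    {upper n i j, lower n k l} \<in> {vedge n k l, ledge n k l, redge n k l}"
  unfolding upper_def lower_def up_inter_down vedge_def ledge_def redge_def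
  by (auto simp: doubleton_eq_iff)

text \<open>The bottom strip has upward triangles only at even positions, so
  \<open>ledge n n j\<close> requires even \<open>j\<close>, and \<open>redge n n j\<close>, which
  ends at position \<open>j + 1\<close>, odd \<open>j\<close>.\<close>

lemma hh_edges_eq:
  "hh_edges n =
    {vedge n k j | k j. 1 \<le> k \<and> k \<le> n \<and> 1 \<le> j \<and> j \<le> n + k} \<union>
    {ledge n k j | k j. k \<le> n \<and> 1 \<le> j \<and> j \<le> n + k \<and> (k = n \<longrightarrow> even j)} \<union>
    {redge n k j | k j. k \<le> n \<and> 1 \<le> j \<and> j \<le> n + k \<and> (k = n \<longrightarrow> odd j)}"
    (is "_ = ?V \<union> ?L \<union> ?R")
proof (intro equalityI subsetI)
  fix e assume "e \<in> hh_edges n"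
  then obtain F G where e: "e = {F, G}" and F: "F \<in> hh_vertices n" and G: "G \<in> hh_vertices n"
    and FG: "card (F \<inter> G) = 2" by (auto simp: hh_edges_def)
  have "\<exists>i j k l. e = {upper n (Suc i) j, lower n k l} \<and> upper n (Suc i) j \<in> hh_vertices n \<and>
      lower n k l \<in> hh_vertices n \<and> card (upper n (Suc i) j \<inter> lower n k l) = 2"
  proof -
    \<comment> \<open>Triangles of equal orientation never share a side, so every edge joins an
      upward to a downward triangle.\<close>
    have "\<not> (\<exists>i j k l. F = upper n i j \<and> G = upper n k l)"
      using FG by (auto simp: upper_def up_inter_up)
    moreover have "\<not> (\<exists>i j k l. F = lower n i j \<and> G = lower n k l)"
      using FG by (auto simp: lower_def down_inter_down)
    ultimately consider i j k l where "F = upper n (Suc i) j" "G = lower n k l"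
      | i j k l where "F = lower n k l" "G = upper n (Suc i) j"
      using F G unfolding hh_vertices_eq by blast
    then show ?thesis using e F G FG by cases (blast, metis Int_commute insert_commute)
  qed
  then obtain i j k l where e: "e = {upper n (Suc i) j, lower n k l}"
      and UL: "upper n (Suc i) j \<in> hh_vertices n" "lower n k l \<in> hh_vertices n"
      and "card (upper n (Suc i) j \<inter> lower n k l) = 2" by blast
  then have "e \<in> {vedge n k l, ledge n k l, redge n k l}" by (simp add: upper_lower_adjacent)
  then consider "e = vedge n k l" "Suc i = k" "j = l" | "e = ledge n k l" "i = k" "j = l"
    | "e = redge n k l" "i = k" "j = Suc l"
    unfolding e by (auto simp: vedge_def ledge_def redge_def doubleton_eq_iff)
  then show "e \<in> ?V \<union> ?L \<union> ?R"
    using UL unfolding lower_mem_hh_vertices upper_mem_hh_vertices by cases auto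
next
  have edgeI: "{upper n i j, lower n k l} \<in> hh_edges n"
    if "upper n i j \<in> hh_vertices n" "lower n k l \<in> hh_vertices n"
      "{upper n i j, lower n k l} \<in> {vedge n k l, ledge n k l, redge n k l}" for i j k l
    using that upper_lower_adjacent[of n i j k l] unfolding hh_edges_def by blast
  fix e assume "e \<in> ?V \<union> ?L \<union> ?R"
  then consider k j where "e = vedge n k j" "1 \<le> k" "k \<le> n" "1 \<le> j" "j \<le> n + k"
    | k j where "e = ledge n k j" "k \<le> n" "1 \<le> j" "j \<le> n + k" "k = n \<longrightarrow> even j"
    | k j where "e = redge n k j" "k \<le> n" "1 \<le> j" "j \<le> n + k" "k = n \<longrightarrow> odd j"
    by blast
  then show "e \<in> hh_edges n"
  proof cases
    case (1 k j)
    then obtain i where "k = Suc i" by (cases k) auto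
    then show ?thesis using edgeI[of k j k j] 1
      by (simp add: vedge_def upper_mem_hh_vertices lower_mem_hh_vertices)
  next
    case (2 k j)
    then show ?thesis using edgeI[of "Suc k" j k j]
      by (simp add: ledge_def upper_mem_hh_vertices lower_mem_hh_vertices insert_commute)
  next
    case (3 k j)
    then show ?thesis using edgeI[of "Suc k" "Suc j" k j]
      by (simp add: redge_def upper_mem_hh_vertices lower_mem_hh_vertices insert_commute)
  qed
qed

lemma lower_mem_edge:
  assumes "e \<in> hh_edges n"
  shows "lower n k j \<in> e \<longleftrightarrow> e \<in> {vedge n k j, ledge n k j, redge n k j}"
proof -
  consider k' j' where "e = vedge n k' j'" | k' j' where "e = ledge n k' j'"
    | k' j' where "e = redge n k' j'" using assms unfolding hh_edges_eq by blast
  then show ?thesis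
    by cases (simp_all, auto simp: vedge_def ledge_def redge_def)
qed

lemma upper_mem_edge:
  assumes "e \<in> hh_edges n" "j \<ge> 1"
  shows "upper n (Suc k) j \<in> e \<longleftrightarrow> e \<in> {vedge n (Suc k) j, ledge n k j, redge n k (j - 1)}"
proof -
  consider k' j' where "e = vedge n k' j'" | k' j' where "e = ledge n k' j'"
    | k' j' where "e = redge n k' j'" using assms(1) unfolding hh_edges_eq by blast
  then show ?thesis
    by cases (simp_all, use assms(2) in \<open>auto simp: vedge_def ledge_def redge_def\<close>)
qed

section \<open>Perfect matchings as linear equations\<close>

lemma ex1_three:
  assumes "a \<noteq> b" "a \<noteq> c" "b \<noteq> c"
  shows "(\<exists>!e. e \<in> M \<and> e \<in> {a, b, c}) \<longleftrightarrow>
    of_bool (a \<in> M) + of_bool (b \<in> M) + of_bool (c \<in> M) = (1 :: int)"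
  using assms by (cases "a \<in> M"; cases "b \<in> M"; cases "c \<in> M") auto

text \<open>Row \<open>n + 1\<close> has no edges in the graph; its odd positions, where \<open>R\<^sub>n\<close> has no triangle, are
  treated as occupied, in line with the fixed bottom row of the tableaux.\<close>

definition vbit :: "nat \<Rightarrow> matching \<Rightarrow> nat \<Rightarrow> nat \<Rightarrow> int" where
  "vbit n M k j = of_bool (if k = Suc n then odd j else vedge n k j \<in> M)"

definition lbit :: "nat \<Rightarrow> matching \<Rightarrow> nat \<Rightarrow> nat \<Rightarrow> int" where
  "lbit n M k j = of_bool (ledge n k j \<in> M)"

definition rbit :: "nat \<Rightarrow> matching \<Rightarrow> nat \<Rightarrow> nat \<Rightarrow> int" where
  "rbit n M k j = of_bool (redge n k j \<in> M)"

text \<open>Each triangle contributes one equation. Edges that do not exist have indicator 0, so the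
  three-term form persists at the ends of the strips.\<close>

lemma HH_iff:
  "M \<in> HH n \<longleftrightarrow> M \<subseteq> hh_edges n \<and>
    (\<forall>k\<le>n. (\<forall>j\<in>{1..n + k}. vbit n M k j + lbit n M k j + rbit n M k j = 1) \<and>
            (\<forall>j\<in>{1..n + k + 1}. vbit n M (Suc k) j + lbit n M k j + rbit n M k (j - 1) = 1))"
proof (cases "M \<subseteq> hh_edges n")
  case False
  then show ?thesis by (auto simp: HH_def)
next
  case True
  have low: "(\<exists>!e. e \<in> M \<and> lower n k j \<in> e) \<longleftrightarrow> vbit n M k j + lbit n M k j + rbit n M k j = 1"
    if "k \<le> n" for k j
  proof -
    have "(\<exists>!e. e \<in> M \<and> lower n k j \<in> e) \<longleftrightarrow>
        (\<exists>!e. e \<in> M \<and> e \<in> {vedge n k j, ledge n k j, redge n k j})"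
      using True lower_mem_edge[of _ n k j] by (intro arg_cong[where f = Ex1] ext) blast
    also have "\<dots> \<longleftrightarrow> of_bool (vedge n k j \<in> M) + of_bool (ledge n k j \<in> M)
        + of_bool (redge n k j \<in> M) = (1 :: int)"
      by (rule ex1_three) simp_all
    finally show ?thesis using that by (simp add: vbit_def lbit_def rbit_def)
  qed
  have upp: "(\<exists>!e. e \<in> M \<and> upper n (Suc k) j \<in> e) \<longleftrightarrow>
      vbit n M (Suc k) j + lbit n M k j + rbit n M k (j - 1) = 1"
    if "k = n \<longrightarrow> even j" "j \<ge> 1" for k j
  proof -
    have "(\<exists>!e. e \<in> M \<and> upper n (Suc k) j \<in> e) \<longleftrightarrow>
        (\<exists>!e. e \<in> M \<and> e \<in> {vedge n (Suc k) j, ledge n k j, redge n k (j - 1)})"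
      using True upper_mem_edge[of _ n j k] that by (intro arg_cong[where f = Ex1] ext) blast
    also have "\<dots> \<longleftrightarrow> of_bool (vedge n (Suc k) j \<in> M) + of_bool (ledge n k j \<in> M)
        + of_bool (redge n k (j - 1) \<in> M) = (1 :: int)"
      by (rule ex1_three) simp_all
    also have "of_bool (vedge n (Suc k) j \<in> M) = vbit n M (Suc k) j"
      using True that(1) by (auto simp: vbit_def hh_edges_eq)
    finally show ?thesis by (simp add: lbit_def rbit_def)
  qed
  \<comment> \<open>No triangle exists at an odd position of row \<open>n + 1\<close>; the
    artificial occupied position makes the equation hold there too.\<close>
  have bottom: "vbit n M (Suc n) j + lbit n M n j + rbit n M n (j - 1) = 1" if "odd j" for j
  proof -
    have "ledge n n j \<notin> M" "redge n n (j - 1) \<notin> M"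
      using True that by (auto simp: hh_edges_eq)
    then show ?thesis using that by (simp add: vbit_def lbit_def rbit_def)
  qed
  have "M \<in> HH n \<longleftrightarrow> (\<forall>F\<in>hh_vertices n. \<exists>!e. e \<in> M \<and> F \<in> e)"
    using True by (simp add: HH_def)
  also have "\<dots> \<longleftrightarrow> (\<forall>k\<le>n. (\<forall>j\<in>{1..n + k}. \<exists>!e. e \<in> M \<and> lower n k j \<in> e) \<and>
      (\<forall>j\<in>{1..n + k + 1}. (k = n \<longrightarrow> even j) \<longrightarrow> (\<exists>!e. e \<in> M \<and> upper n (Suc k) j \<in> e)))"
    by (rule ball_hh_vertices)
  also have "\<dots> \<longleftrightarrow>
    (\<forall>k\<le>n. (\<forall>j\<in>{1..n + k}. vbit n M k j + lbit n M k j + rbit n M k j = 1) \<and>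
            (\<forall>j\<in>{1..n + k + 1}. vbit n M (Suc k) j + lbit n M k j + rbit n M k (j - 1) = 1))"
  proof (intro all_cong conj_cong ball_cong refl)
    fix k j assume "k \<le> n" "j \<in> {1..n + k + 1}"
    then show "((k = n \<longrightarrow> even j) \<longrightarrow> (\<exists>!e. e \<in> M \<and> upper n (Suc k) j \<in> e)) \<longleftrightarrow>
        vbit n M (Suc k) j + lbit n M k j + rbit n M k (j - 1) = 1"
      using upp[of k j] bottom[of j] by (cases "k = n \<longrightarrow> even j") auto
  qed (rule low)
  finally show ?thesis using True by simp
qed

section \<open>Recognising vertical edges by their centres\<close>

lemma edge_centres:
  "edge_centre (vedge n k j) = lat (int j - int n - 1 / 2) (int n - int k)"
  "edge_centre (ledge n k j) = lat (int j - int n - 1 / 2) (int n - int k - 1 / 2)"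
  "edge_centre (redge n k j) = lat (int j - int n) (int n - int k - 1 / 2)"
proof -
  have *: "edge_centre {upper n i j, lower n k l} =
      lat ((int j + int l - 2 * int n - 1) / 2) ((2 * int n - int i - int k) / 2)" for i j k l
    using lat_divide[of "int j + int l - 2 * int n - 1" "2 * int n - int i - int k" 2]
    by (simp add: edge_centre_def upper_def lower_def face_centre_up face_centre_down lat_add)
       (simp add: algebra_simps)
  show "edge_centre (vedge n k j) = lat (int j - int n - 1 / 2) (int n - int k)"
    unfolding vedge_def * by (simp add: field_simps)
  show "edge_centre (ledge n k j) = lat (int j - int n - 1 / 2) (int n - int k - 1 / 2)"
    unfolding ledge_def insert_commute[of "lower n k j"] * by (simp add: field_simps)
  show "edge_centre (redge n k j) = lat (int j - int n) (int n - int k - 1 / 2)"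
    unfolding redge_def insert_commute[of "lower n k j"] * by (simp add: field_simps)
qed

lemma half_noninteger: "real_of_int a \<noteq> real_of_int b - 1 / 2"
proof
  assume "real_of_int a = real_of_int b - 1 / 2"
  then have "real_of_int (2 * a) = of_int (2 * b - 1)" by simp
  then have "2 * a = 2 * b - 1" unfolding of_int_eq_iff .
  then show False by presburger
qed

text \<open>The centres of \<open>ledge\<close> and \<open>redge\<close> have a half-integer second
  lattice coordinate, so only a \<open>vedge\<close> can sit at a
  \<open>vertical_centre\<close>.\<close>

lemma vertical_positions_eq:
  assumes "M \<subseteq> hh_edges n"
  shows "vertical_positions n M k = {j. 1 \<le> j \<and> j \<le> n + k \<and> vedge n k j \<in> M}"
proof -
  have vc: "vertical_centre n k j = lat (int j - int n - 1 / 2) (int n - int k)" for j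
    by (simp add: vertical_centre_def lat_def)
  have "e = vedge n k j" if e: "e \<in> M" "edge_centre e = vertical_centre n k j" for e j
  proof -
    have ne: "real_of_int (int n - int k') - 1 / 2 \<noteq> of_int (int n - int k)" for k'
      using half_noninteger by metis
    have "e \<in> hh_edges n" using e(1) assms by auto
    then consider k' j' where "e = vedge n k' j'" | k' j' where "e = ledge n k' j'"
      | k' j' where "e = redge n k' j'" unfolding hh_edges_eq by blast
    then show ?thesis
      using e(2) ne unfolding vc by cases (auto simp: edge_centres)
  qed
  then show ?thesis unfolding vertical_positions_def using vc edge_centres(1) by (auto, metis+)
qed

section \<open>The bijection between matchings and tableaux\<close>

definition enumerates :: "(nat \<Rightarrow> int) \<Rightarrow> nat \<Rightarrow> nat set \<Rightarrow> bool" where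
  "enumerates r k Q \<longleftrightarrow> strict_mono_on {..<k} r \<and> r ` {..<k} = int ` Q"

text \<open>Counting functions mediate between the two sides: for a matching they are partial sums
  of \<open>vbit\<close>, and for tableaux they express interlacing.\<close>

definition count_upto :: "(nat \<Rightarrow> int) \<Rightarrow> nat \<Rightarrow> int \<Rightarrow> nat" where
  "count_upto r k x = card {s. s < k \<and> r s \<le> x}"

text \<open>As \<open>r\<close> increases, the indices with \<open>r s \<le> x\<close> form an
  initial segment. Hence a row and its counting function determine each other.\<close>

lemma less_count_upto_iff:
  assumes r: "strict_mono_on {..<k} r" and t: "t < k"
  shows "t < count_upto r k x \<longleftrightarrow> r t \<le> x"
proof
  assume "t < count_upto r k x"
  show "r t \<le> x"
  proof (rule ccontr)
    assume "\<not> r t \<le> x"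
    then have "{s. s < k \<and> r s \<le> x} \<subseteq> {..<t}"
      using strict_mono_on_leD[OF r, of t] t by force
    then have "count_upto r k x \<le> card {..<t}" unfolding count_upto_def by (intro card_mono) auto
    with \<open>t < count_upto r k x\<close> show False by simp
  qed
next
  assume "r t \<le> x"
  then have "{..t} \<subseteq> {s. s < k \<and> r s \<le> x}"
    using strict_mono_on_leD[OF r, of _ t] t by force
  then have "card {..t} \<le> count_upto r k x" unfolding count_upto_def by (intro card_mono) auto
  then show "t < count_upto r k x" by simp
qed

lemma count_upto_enumerates:
  assumes "enumerates r k Q"
  shows "count_upto r k (int j) = card {t \<in> Q. t \<le> j}"
proof -
  have inj: "inj_on r {..<k}"
    using assms strict_mono_on_imp_inj_on by (auto simp: enumerates_def)
  have "r ` {s. s < k \<and> r s \<le> int j} = {x \<in> r ` {..<k}. x \<le> int j}" by auto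
  also have "\<dots> = int ` {t \<in> Q. t \<le> j}" using assms by (auto simp: enumerates_def)
  finally have "card (r ` {s. s < k \<and> r s \<le> int j}) = card (int ` {t \<in> Q. t \<le> j})" by simp
  then show ?thesis unfolding count_upto_def
    using card_image[OF inj_on_subset[OF inj], of "{s. s < k \<and> r s \<le> int j}"]
    by (simp add: card_image subset_eq)
qed

text \<open>The counting function depends only on \<open>Q\<close>, and it recovers each entry by
  \<open>less_count_upto_iff\<close>.\<close>

lemma enumerates_unique:
  assumes "enumerates r k Q" "enumerates r' k Q" "t < k"
  shows "r t = r' t"
proof -
  have le: "f t \<le> f' t" if f: "enumerates f k Q" "enumerates f' k Q" for f f'
  proof -
    obtain j where j: "f' t = int j" using f(2) assms(3) by (auto simp: enumerates_def)
    have "t < count_upto f' k (int j)"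
      using less_count_upto_iff[of k f' t] f(2) j assms(3) by (simp add: enumerates_def)
    then have "t < count_upto f k (int j)"
      using count_upto_enumerates[OF f(1)] count_upto_enumerates[OF f(2)] by simp
    then show ?thesis
      using less_count_upto_iff[of k f t] f(1) j assms(3) by (simp add: enumerates_def)
  qed
  show ?thesis using le[OF assms(1,2)] le[OF assms(2,1)] by simp
qed

lemma enumerates_sorted_list_of_set:
  assumes "finite Q" "card Q = k"
  shows "enumerates (\<lambda>t. int (sorted_list_of_set Q ! t)) k Q"
proof -
  have "length (sorted_list_of_set Q) = k" using assms by simp
  moreover have "set (sorted_list_of_set Q) = Q" using assms by simp
  moreover have "sorted_wrt (<) (sorted_list_of_set Q)" by simp
  ultimately have "strict_mono_on {..<k} (\<lambda>t. int (sorted_list_of_set Q ! t))"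
      and "(\<lambda>t. sorted_list_of_set Q ! t) ` {..<k} = Q"
    by (auto simp: strict_mono_on_def sorted_wrt_nth_less set_conv_nth)
  then show ?thesis unfolding enumerates_def by (metis image_image)
qed

lemma enumerates_odds: "enumerates (\<lambda>t. 2 * int t + 1) (Suc n) {j. odd j \<and> 1 \<le> j \<and> j \<le> 2 * n + 1}"
proof -
  have "(\<lambda>t. 2 * t + 1) ` {..<Suc n} = {j. odd j \<and> 1 \<le> j \<and> j \<le> 2 * n + 1}"
    by (auto simp: image_iff elim!: oddE)
  then have "(\<lambda>t. 2 * int t + 1) ` {..<Suc n} = int ` {j. odd j \<and> 1 \<le> j \<and> j \<le> 2 * n + 1}"
    by (subst (asm) eq_commute) (simp add: image_image add.commute)
  then show ?thesis by (simp add: enumerates_def strict_mono_on_def)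
qed

text \<open>It suffices to compare counts at the entries \<open>r t\<close> and
  \<open>r' (Suc t)\<close> themselves, where the count of the own row is at least
  \<open>t + 1\<close> and \<open>t + 2\<close> respectively.\<close>

lemma interlacing_from_counts:
  assumes r: "strict_mono_on {..<k} r" and r': "strict_mono_on {..<Suc k} r'" and t: "t < k"
    and 1: "count_upto r k (r t) \<le> count_upto r' (Suc k) (r t)"
    and 2: "count_upto r' (Suc k) (r' (Suc t)) \<le> Suc (count_upto r k (r' (Suc t) - 1))"
  shows "r' t \<le> r t \<and> r t < r' (Suc t)"
proof
  have "t < count_upto r k (r t)" using less_count_upto_iff[OF r t] by simp
  with 1 have "t < count_upto r' (Suc k) (r t)" by simp
  then show "r' t \<le> r t" using less_count_upto_iff[OF r', of t] t by simp
  have "Suc t < count_upto r' (Suc k) (r' (Suc t))"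
    using less_count_upto_iff[OF r', of "Suc t"] t by simp
  with 2 have "t < count_upto r k (r' (Suc t) - 1)" by simp
  then show "r t < r' (Suc t)" using less_count_upto_iff[OF r t] by simp
qed

text \<open>The first bound keeps the index \<open>s\<close>; the second sends \<open>s\<close> to
  \<open>s - 1\<close>, and the leftover index 0 accounts for the \<open>Suc\<close>.\<close>

lemma counts_from_interlacing:
  assumes "\<And>t. t < k \<Longrightarrow> r' t \<le> r t \<and> r t < r' (Suc t)"
  shows "count_upto r k x \<le> count_upto r' (Suc k) x"
    and "count_upto r' (Suc k) x \<le> Suc (count_upto r k (x - 1))"
proof -
  have "{s. s < k \<and> r s \<le> x} \<subseteq> {s. s < Suc k \<and> r' s \<le> x}" using assms by force
  then show "count_upto r k x \<le> count_upto r' (Suc k) x"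
    unfolding count_upto_def by (intro card_mono) auto
  have "s \<in> insert 0 (Suc ` {s. s < k \<and> r s \<le> x - 1})" if "s < Suc k" "r' s \<le> x" for s
    using that assms[of "s - 1"] by (cases s) auto
  then have "{s. s < Suc k \<and> r' s \<le> x} \<subseteq> insert 0 (Suc ` {s. s < k \<and> r s \<le> x - 1})" by auto
  then have "count_upto r' (Suc k) x \<le> card (insert 0 (Suc ` {s. s < k \<and> r s \<le> x - 1}))"
    unfolding count_upto_def by (intro card_mono) auto
  then show "count_upto r' (Suc k) x \<le> Suc (count_upto r k (x - 1))"
    unfolding count_upto_def by (simp add: card_insert_if card_image)
qed

section \<open>Strips determined by their vertical edges\<close>

definition vsum :: "nat \<Rightarrow> matching \<Rightarrow> nat \<Rightarrow> nat \<Rightarrow> int" where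
  "vsum n M k j = (\<Sum>t = 1..j. vbit n M k t)"

lemma vsum_Suc: "vsum n M k (Suc j) = vsum n M k j + vbit n M k (Suc j)"
  and vsum_0: "vsum n M k 0 = 0"
  by (simp_all add: vsum_def)

lemma HH_sum_at_lower:
  assumes "M \<in> HH n" "k \<le> n" "1 \<le> j" "j \<le> n + k"
  shows "vbit n M k j + lbit n M k j + rbit n M k j = 1"
  using assms by (auto simp: HH_iff)

lemma HH_sum_at_upper:
  assumes "M \<in> HH n" "k \<le> n" "1 \<le> j" "j \<le> n + k + 1"
  shows "vbit n M (Suc k) j + lbit n M k j + rbit n M k (j - 1) = 1"
  using assms unfolding HH_iff by (auto dest!: bspec[of "{_.._}" _ j])

text \<open>Subtracting the equations at \<open>lower n k (Suc j)\<close> and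
  \<open>upper n (Suc k) (Suc j)\<close> eliminates \<open>lbit\<close>; the increments of
  \<open>rbit\<close> telescope from \<open>redge n k 0\<close>, which is not an edge.\<close>

lemma rbit_eq_vsum:
  assumes M: "M \<in> HH n" and k: "k \<le> n"
  shows "j \<le> n + k \<Longrightarrow> rbit n M k j = vsum n M (Suc k) j - vsum n M k j"
proof (induction j)
  case 0
  have "redge n k 0 \<notin> M" using M by (auto simp: HH_def hh_edges_eq)
  then show ?case by (simp add: rbit_def vsum_0)
next
  case (Suc j)
  then show ?case
    using HH_sum_at_lower[OF M k, of "Suc j"] HH_sum_at_upper[OF M k, of "Suc j"] by (simp add: vsum_Suc)
qed

lemma lbit_eq_vsum:
  assumes M: "M \<in> HH n" and k: "k \<le> n" and "1 \<le> j" "j \<le> n + k + 1"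
  shows "lbit n M k j = 1 - vsum n M (Suc k) j + vsum n M k (j - 1)"
  using HH_sum_at_upper[OF assms] rbit_eq_vsum[OF M k, of "j - 1"] assms(3,4)
  by (cases j) (simp_all add: vsum_Suc)

text \<open>The strip ends at position \<open>n + k + 1\<close>, where \<open>ledge\<close> does not
  exist, so by \<open>lbit_eq_vsum\<close> each row holds one vertical edge more than the row
  above.\<close>

lemma vsum_total:
  assumes M: "M \<in> HH n"
  shows "k \<le> Suc n \<Longrightarrow> vsum n M k (n + k) = int k"
proof (induction k)
  case 0
  have "vedge n 0 t \<notin> M" for t using M by (auto simp: HH_def hh_edges_eq)
  then show ?case by (simp add: vsum_def vbit_def)
next
  case (Suc k)
  have "ledge n k (n + k + 1) \<notin> M" using M by (auto simp: HH_def hh_edges_eq)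
  then have "lbit n M k (n + k + 1) = 0" by (simp add: lbit_def)
  then show ?case using lbit_eq_vsum[OF M, of k "n + k + 1"] Suc by simp
qed

text \<open>Extends \<open>vertical_positions\<close> to the artificial row \<open>n + 1\<close>, so
  that the fixed bottom row of the tableau is treated like the others.\<close>

definition row_positions :: "nat \<Rightarrow> matching \<Rightarrow> nat \<Rightarrow> nat set" where
  "row_positions n M k = {j. 1 \<le> j \<and> j \<le> n + k \<and> vbit n M k j = 1}"

lemma finite_row_positions: "finite (row_positions n M k)"
  by (rule finite_subset[of _ "{..n + k}"]) (auto simp: row_positions_def)

lemma vsum_eq_card:
  assumes "j \<le> n + k"
  shows "vsum n M k j = int (card {t \<in> row_positions n M k. t \<le> j})"
proof -
  have "vsum n M k j = (\<Sum>t \<in> {1..j}. of_bool (vbit n M k t = 1))"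
    unfolding vsum_def by (intro sum.cong) (auto simp: vbit_def)
  also have "\<dots> = int (card ({1..j} \<inter> {t. vbit n M k t = 1}))"
    by (simp add: of_bool_def sum.If_cases)
  also have "{1..j} \<inter> {t. vbit n M k t = 1} = {t \<in> row_positions n M k. t \<le> j}"
    using assms by (auto simp: row_positions_def)
  finally show ?thesis .
qed

lemma enumerates_tableau_of:
  assumes M: "M \<in> HH n" and i: "i \<le> n"
  shows "enumerates (tableau_of n M i) (Suc i) (row_positions n M (Suc i))"
proof (cases "i = n")
  case True
  have "row_positions n M (Suc n) = {j. odd j \<and> 1 \<le> j \<and> j \<le> 2 * n + 1}"
    by (auto simp: row_positions_def vbit_def)
  then have "enumerates (\<lambda>t. 2 * int t + 1) (Suc n) (row_positions n M (Suc n))"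
    using enumerates_odds by simp
  moreover have "tableau_of n M n t = 2 * int t + 1" if "t < Suc n" for t
    using that by (simp add: tableau_of_def)
  ultimately show ?thesis unfolding True enumerates_def strict_mono_on_def by simp
next
  case False
  have "{t \<in> row_positions n M (Suc i). t \<le> n + Suc i} = row_positions n M (Suc i)"
    by (auto simp: row_positions_def)
  then have "card (row_positions n M (Suc i)) = Suc i"
    using vsum_total[OF M, of "Suc i"] vsum_eq_card[of "n + Suc i" n "Suc i" M] i by simp
  then have *: "enumerates (\<lambda>t. int (sorted_list_of_set (row_positions n M (Suc i)) ! t)) (Suc i)
      (row_positions n M (Suc i))"
    by (intro enumerates_sorted_list_of_set finite_row_positions)
  have "row_positions n M (Suc i) = vertical_positions n M (Suc i)"
    using M False i by (subst vertical_positions_eq) (auto simp: row_positions_def HH_def vbit_def)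
  then have "tableau_of n M i t = int (sorted_list_of_set (row_positions n M (Suc i)) ! t)"
    if "t < Suc i" for t
    using that i False by (simp add: tableau_of_def)
  with * show ?thesis unfolding enumerates_def strict_mono_on_def by simp
qed

lemma count_upto_tableau_of:
  assumes "M \<in> HH n" "i \<le> n" "j \<le> n + Suc i"
  shows "int (count_upto (tableau_of n M i) (Suc i) (int j)) = vsum n M (Suc i) j"
  using count_upto_enumerates[OF enumerates_tableau_of[OF assms(1,2)]] vsum_eq_card[OF assms(3)]
  by simp

lemma tableau_of_mem_row:
  assumes "M \<in> HH n" "i \<le> n" "t \<le> i"
  obtains j where "tableau_of n M i t = int j" "1 \<le> j" "j \<le> n + Suc i"
proof -
  have "tableau_of n M i t \<in> int ` row_positions n M (Suc i)"
    using enumerates_tableau_of[OF assms(1,2)] assms(3) by (auto simp: enumerates_def)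
  then show thesis using that by (auto simp: row_positions_def)
qed

text \<open>Nonnegativity of \<open>rbit\<close> and \<open>lbit\<close>, rewritten by partial sums,
  gives the two count inequalities of \<open>interlacing_from_counts\<close>.\<close>

lemma tableau_of_in_ST:
  assumes M: "M \<in> HH n"
  shows "tableau_of n M \<in> ST n"
proof -
  have "tableau_of n M (Suc i) t \<le> tableau_of n M i t \<and>
      tableau_of n M i t < tableau_of n M (Suc i) (Suc t)" if i: "Suc i \<le> n" and t: "t \<le> i" for i t
  proof (rule interlacing_from_counts[where k = "Suc i"])
    show "strict_mono_on {..<Suc i} (tableau_of n M i)"
      "strict_mono_on {..<Suc (Suc i)} (tableau_of n M (Suc i))"
      using enumerates_tableau_of[OF M] i by (auto simp: enumerates_def)
    show "t < Suc i" using t by simp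
    obtain j where j: "tableau_of n M i t = int j" "j \<le> n + Suc i"
      using tableau_of_mem_row[OF M, of i t] i t by auto
    have "0 \<le> rbit n M (Suc i) j" by (simp add: rbit_def)
    then have "vsum n M (Suc i) j \<le> vsum n M (Suc (Suc i)) j"
      using rbit_eq_vsum[OF M, of "Suc i" j] i j by simp
    then show "count_upto (tableau_of n M i) (Suc i) (tableau_of n M i t)
        \<le> count_upto (tableau_of n M (Suc i)) (Suc (Suc i)) (tableau_of n M i t)"
      using count_upto_tableau_of[OF M, of i j] count_upto_tableau_of[OF M, of "Suc i" j] i j
      by simp
    obtain l where l: "tableau_of n M (Suc i) (Suc t) = int l" "1 \<le> l" "l \<le> n + Suc (Suc i)"
      using tableau_of_mem_row[OF M, of "Suc i" "Suc t"] i t by auto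
    \<comment> \<open>\<open>lbit\<close> at \<open>l\<close> compares the lower row up to
      \<open>l\<close> with the upper row up to \<open>l - 1\<close>; this shift yields the strict
      inequality of the interlacing.\<close>
    have "0 \<le> lbit n M (Suc i) l" by (simp add: lbit_def)
    then have "vsum n M (Suc (Suc i)) l \<le> 1 + vsum n M (Suc i) (l - 1)"
      using lbit_eq_vsum[OF M, of "Suc i" l] i l by simp
    moreover have l1: "int l - 1 = int (l - 1)" "l - 1 \<le> n + Suc i" using l by simp_all
    ultimately show "count_upto (tableau_of n M (Suc i)) (Suc (Suc i)) (tableau_of n M (Suc i) (Suc t))
        \<le> Suc (count_upto (tableau_of n M i) (Suc i) (tableau_of n M (Suc i) (Suc t) - 1))"
      unfolding l(1) l1(1)
      using count_upto_tableau_of[OF M Suc_leD[OF i] l1(2)] count_upto_tableau_of[OF M i l(3)]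
      by linarith
  qed
  then have "\<forall>i\<in>{1..n}. \<forall>j\<le>i - 1. tableau_of n M i j \<le> tableau_of n M (i - 1) j \<and>
      tableau_of n M (i - 1) j < tableau_of n M i (j + 1)"
    by (metis One_nat_def Suc_eq_plus1 atLeastAtMost_iff diff_Suc_1 not0_implies_Suc not_one_le_zero)
  then show ?thesis unfolding ST_def by (simp add: tableau_of_def)
qed

text \<open>The tableau determines the vertical edges, hence all partial sums, and these determine
  the remaining edges of every strip.\<close>

lemma inj_on_tableau_of: "inj_on (tableau_of n) (HH n)"
proof (rule inj_onI)
  fix M M' assume M: "M \<in> HH n" and M': "M' \<in> HH n" and eq: "tableau_of n M = tableau_of n M'"
  have v: "vbit n M k j = vbit n M' k j" if "k \<le> Suc n" "1 \<le> j" "j \<le> n + k" for k j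
  proof (cases k)
    case 0
    have "vedge n 0 j \<notin> M" "vedge n 0 j \<notin> M'" using M M' by (auto simp: HH_def hh_edges_eq)
    then show ?thesis using 0 by (simp add: vbit_def)
  next
    case (Suc i)
    have "int ` row_positions n M (Suc i) = int ` row_positions n M' (Suc i)"
      using enumerates_tableau_of[OF M, of i] enumerates_tableau_of[OF M', of i] that Suc eq
      by (simp add: enumerates_def)
    then have "row_positions n M k = row_positions n M' k" using Suc by (simp add: inj_image_eq_iff)
    then have "vbit n M k j = 1 \<longleftrightarrow> vbit n M' k j = 1" using that by (auto simp: row_positions_def)
    then show ?thesis by (auto simp: vbit_def split: if_splits)
  qed
  have vs: "vsum n M k j = vsum n M' k j" if "k \<le> Suc n" "j \<le> n + k" for k j
    unfolding vsum_def using that by (intro sum.cong v) auto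
  have r: "rbit n M k j = rbit n M' k j" if "k \<le> n" "j \<le> n + k" for k j
    using that vs by (simp add: rbit_eq_vsum[OF M] rbit_eq_vsum[OF M'])
  have l: "lbit n M k j = lbit n M' k j" if "k \<le> n" "1 \<le> j" "j \<le> n + k" for k j
    using that vs by (simp add: lbit_eq_vsum[OF M] lbit_eq_vsum[OF M'])
  have "e \<in> M \<longleftrightarrow> e \<in> M'" if "e \<in> hh_edges n" for e
  proof -
    consider k j where "e = vedge n k j" "1 \<le> k" "k \<le> n" "1 \<le> j" "j \<le> n + k"
      | k j where "e = ledge n k j" "k \<le> n" "1 \<le> j" "j \<le> n + k"
      | k j where "e = redge n k j" "k \<le> n" "1 \<le> j" "j \<le> n + k"
      using \<open>e \<in> hh_edges n\<close> unfolding hh_edges_eq by blast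
    then show ?thesis
    proof cases
      case (1 k j)
      then show ?thesis using v[of k j] by (simp add: vbit_def of_bool_eq_iff)
    next
      case (2 k j)
      then show ?thesis using l[of k j] by (simp add: lbit_def of_bool_eq_iff)
    next
      case (3 k j)
      then show ?thesis using r[of k j] by (simp add: rbit_def of_bool_eq_iff)
    qed
  qed
  moreover have "M \<subseteq> hh_edges n" "M' \<subseteq> hh_edges n" using M M' by (auto simp: HH_def)
  ultimately show "M = M'" by blast
qed

section \<open>Building a matching from a tableau\<close>

lemma ST_D:
  assumes "g \<in> ST n" "Suc i \<le> n" "j \<le> i"
  shows "g (Suc i) j \<le> g i j" "g i j < g (Suc i) (Suc j)"
  using assms by (auto simp: ST_def dest!: bspec[of _ _ "Suc i"])

text \<open>Induction upwards from the bottom row; the upper bound drops by one per row because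
  interlacing is strict on the right.\<close>

lemma ST_bounds:
  assumes g: "g \<in> ST n" and i: "i \<le> n"
  shows "j \<le> i \<Longrightarrow> 1 \<le> g i j \<and> g i j \<le> int (n + Suc i)"
  using i
proof (induction i arbitrary: j rule: inc_induct)
  case base
  then show ?case using g by (simp add: ST_def)
next
  case (step i)
  have "1 \<le> g (Suc i) j" "g (Suc i) (Suc j) \<le> int (n + Suc (Suc i))"
    using step.IH[of j] step.IH[of "Suc j"] step.prems by simp_all
  moreover have "g (Suc i) j \<le> g i j" "g i j < g (Suc i) (Suc j)"
    using ST_D[OF g] step.hyps step.prems by simp_all
  ultimately show ?case by simp
qed

text \<open>Neighbours in a row are separated by the row below:
  \<open>g i j < g (Suc i) (Suc j) \<le> g i (Suc j)\<close>. The bottom row is explicit.\<close>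

lemma strict_mono_on_ST_row:
  assumes g: "g \<in> ST n" and i: "i \<le> n"
  shows "strict_mono_on {..<Suc i} (g i)"
proof -
  have Suc: "g i j < g i (Suc j)" if "Suc j \<le> i" for j
  proof (cases "i = n")
    case True
    then show ?thesis using g that by (simp add: ST_def)
  next
    case False
    then show ?thesis using ST_D[OF g, of i j] ST_D[OF g, of i "Suc j"] i that by simp
  qed
  have "s < t \<Longrightarrow> t \<le> i \<Longrightarrow> g i s < g i t" for s t
  proof (induction t)
    case (Suc t)
    then show ?case using assms Suc.IH \<open>\<And>j. Suc j \<le> i \<Longrightarrow> g i j < g i (Suc j)\<close>[of t]
      by (cases "s = t") auto
  qed simp
  then show ?thesis by (auto simp: strict_mono_on_def)
qed

text \<open>The tableau prescribes the vertical edges; \<open>lbit_eq_vsum\<close> and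
  \<open>rbit_eq_vsum\<close> dictate the only candidates \<open>L\<close> and \<open>R\<close> for
  the other indicators. Interlacing makes these 0 or 1, and the matching equations then hold
  identically.\<close>

lemma ST_subset_image: "ST n \<subseteq> tableau_of n ` HH n"
proof
  fix g assume g: "g \<in> ST n"
  \<comment> \<open>\<open>Q k\<close> is the intended row \<open>k\<close> of vertical edges, read
    from tableau row \<open>k - 1\<close> and empty for \<open>k = 0\<close>.\<close>
  define Q where "Q k = {j. \<exists>t<k. g (k - 1) t = int j}" for k
  define S where "S k j = int (card {t \<in> Q k. t \<le> j})" for k j
  define L where "L k j = 1 - S (Suc k) j + S k (j - 1)" for k j
  define R where "R k j = S (Suc k) j - S k j" for k j
  have Q0: "Q 0 = {}" by (simp add: Q_def)
  have Q_bounds: "1 \<le> j \<and> j \<le> n + k" if "k \<le> Suc n" "j \<in> Q k" for k j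
  proof -
    obtain t where t: "t < k" "g (k - 1) t = int j" using \<open>j \<in> Q k\<close> by (auto simp: Q_def)
    then show ?thesis using ST_bounds[OF g, of "k - 1" t] that(1) by (cases k) auto
  qed
  have enum: "enumerates (g i) (Suc i) (Q (Suc i))" if "i \<le> n" for i
  proof -
    have "\<exists>j. g i t = int j" if "t < Suc i" for t
      using ST_bounds[OF g \<open>i \<le> n\<close>, of t] that by (intro exI[of _ "nat (g i t)"]) auto
    then have "int ` Q (Suc i) = g i ` {..<Suc i}"
      unfolding Q_def by (auto simp: image_iff) (metis lessThan_iff, metis)
    then show ?thesis using strict_mono_on_ST_row[OF g that] unfolding enumerates_def by simp
  qed
  have Q_bottom: "j \<in> Q (Suc n) \<longleftrightarrow> odd j" if "1 \<le> j" "j \<le> 2 * n + 1" for j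
  proof -
    have "g n ` {..<Suc n} = (\<lambda>t. 2 * int t + 1) ` {..<Suc n}"
      using g by (intro image_cong) (auto simp: ST_def)
    then have "int ` Q (Suc n) = int ` {j. odd j \<and> 1 \<le> j \<and> j \<le> 2 * n + 1}"
      using enum[of n] enumerates_odds[of n] by (simp add: enumerates_def)
    then have "Q (Suc n) = {j. odd j \<and> 1 \<le> j \<and> j \<le> 2 * n + 1}" by (simp add: inj_image_eq_iff)
    then show ?thesis using that by simp
  qed
  have S_eq: "S (Suc i) j = int (count_upto (g i) (Suc i) (int j))" if "i \<le> n" for i j
    unfolding S_def using count_upto_enumerates[OF enum[OF that]] by simp
  have S_0: "S k 0 = 0" if "k \<le> Suc n" for k
    using Q_bounds[OF that] by (force simp: S_def)
  have S_Suc: "S k (Suc j) = S k j + of_bool (Suc j \<in> Q k)" if "k \<le> Suc n" for k j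
  proof -
    have "{t \<in> Q k. t \<le> Suc j} = (if Suc j \<in> Q k then insert (Suc j) else id) {t \<in> Q k. t \<le> j}"
      by (auto simp: le_Suc_eq)
    then show ?thesis by (simp add: S_def)
  qed
  have S_le: "S k j \<le> S (Suc k) j" "S (Suc k) (Suc j) \<le> 1 + S k j" if k: "k \<le> n" for k j
  proof -
    have "S k j \<le> S (Suc k) j \<and> S (Suc k) (Suc j) \<le> 1 + S k j"
    proof (cases k)
      case 0
      have "S (Suc 0) (Suc j) \<le> 1"
        using card_mono[of "{..<1::nat}" "{s. s < Suc 0 \<and> g 0 s \<le> int (Suc j)}"]
        unfolding S_eq[OF le0] count_upto_def by auto
      then show ?thesis using 0 by (simp add: S_def Q0)
    next
      case (Suc i)
      have "g (Suc i) t \<le> g i t \<and> g i t < g (Suc i) (Suc t)" if "t < Suc i" for t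
        using ST_D[OF g, of i t] k Suc that by simp
      from counts_from_interlacing[of "Suc i" "g (Suc i)" "g i", OF this]
      show ?thesis using S_eq[of i] S_eq[of "Suc i"] k Suc
        by (metis (no_types, lifting) Suc_leD of_nat_Suc of_nat_le_iff add_diff_cancel_left')
    qed
    then show "S k j \<le> S (Suc k) j" "S (Suc k) (Suc j) \<le> 1 + S k j" by auto
  qed
  have S_total: "S k (n + k) = int k" if "k \<le> Suc n" for k
  proof (cases k)
    case (Suc i)
    have "{t. t < Suc i \<and> g i t \<le> int (n + Suc i)} = {..<Suc i}"
      using ST_bounds[OF g, of i] that Suc by auto
    then show ?thesis using S_eq[of i "n + Suc i"] that Suc by (simp add: count_upto_def)
  qed (simp add: S_def Q0)
  \<comment> \<open>The upper bound combines \<open>S (Suc k) (Suc l) \<le> 1 + S k l\<close> with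
    the monotonicity of \<open>S k\<close>.\<close>
  have R01: "R k j \<in> {0, 1}" if "k \<le> n" for k j
  proof (cases j)
    case (Suc l)
    then show ?thesis
      using S_le[OF that, of j] S_le[OF that, of l] S_Suc[of k l] that by (auto simp: R_def)
  qed (use S_0 that in \<open>simp add: R_def\<close>)
  have L01: "L k j \<in> {0, 1}" if "k \<le> n" "1 \<le> j" for k j
  proof (cases j)
    case (Suc l)
    then show ?thesis
      using S_le[OF that(1), of l] S_Suc[of "Suc k" l] that by (auto simp: L_def)
  qed (use that in simp)
  define M where "M = {vedge n k j | k j. 1 \<le> k \<and> k \<le> n \<and> 1 \<le> j \<and> j \<le> n + k \<and> j \<in> Q k} \<union>
    {ledge n k j | k j. k \<le> n \<and> 1 \<le> j \<and> j \<le> n + k \<and> L k j = 1} \<union>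
    {redge n k j | k j. k \<le> n \<and> 1 \<le> j \<and> j \<le> n + k \<and> R k j = 1}"
  have v: "vbit n M k j = of_bool (j \<in> Q k)" if "k \<le> Suc n" "1 \<le> j" "j \<le> n + k" for k j
    using that Q_bottom[of j] by (cases "k = 0") (auto simp: vbit_def M_def Q0)
  have l: "lbit n M k j = L k j" if "k \<le> n" "1 \<le> j" "j \<le> n + k + 1" for k j
  proof (cases "j = n + k + 1")
    case True
    then have "lbit n M k j = 0" by (auto simp: lbit_def M_def)
    \<comment> \<open>At the end of the strip the totals give
      \<open>L k j = 1 - (k + 1) + k = 0\<close>, in agreement with the missing edge.\<close>
    then show ?thesis using S_total[of k] S_total[of "Suc k"] that True by (simp add: L_def)
  next
    case False
    then show ?thesis using that L01[of k j] by (auto simp: lbit_def M_def)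
  qed
  have r: "rbit n M k j = R k j" if "k \<le> n" "j \<le> n + k" for k j
  proof (cases "j = 0")
    case True
    then show ?thesis using S_0 that by (auto simp: rbit_def M_def R_def)
  next
    case False
    then show ?thesis using that R01[of k j] by (auto simp: rbit_def M_def)
  qed
  have "M \<subseteq> hh_edges n"
  proof
    fix e assume "e \<in> M"
    then consider k j where "e = vedge n k j" "1 \<le> k" "k \<le> n" "1 \<le> j" "j \<le> n + k"
      | k j where "e = ledge n k j" "k \<le> n" "1 \<le> j" "j \<le> n + k" "L k j = 1"
      | k j where "e = redge n k j" "k \<le> n" "1 \<le> j" "j \<le> n + k" "R k j = 1"
      unfolding M_def by blast
    then show "e \<in> hh_edges n"
    proof cases
      case (1 k j)
      then show ?thesis unfolding hh_edges_eq by blast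
    next
      case (2 k j)
      \<comment> \<open>\<open>L n j = 1\<close> forces \<open>S (Suc n)\<close> not to jump at
        \<open>j\<close>, so \<open>j\<close> is not one of the odd positions of row
        \<open>n + 1\<close>.\<close>
      have "even j" if "k = n"
      proof -
        obtain i where "j = Suc i" using 2 by (cases j) auto
        then have "j \<notin> Q (Suc n)"
          using 2 that S_le[of n i] S_Suc[of "Suc n" i] by (auto simp: L_def)
        then show ?thesis using Q_bottom[of j] 2 that by simp
      qed
      then show ?thesis unfolding hh_edges_eq using 2 by blast
    next
      case (3 k j)
      \<comment> \<open>\<open>R n j = 1\<close> prevents a jump of \<open>S (Suc n)\<close> at
        \<open>j + 1\<close>, so \<open>j + 1\<close> is even.\<close>
      have "odd j" if "k = n"
      proof -
        have "Suc j \<notin> Q (Suc n)"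
          using 3 that S_le[of n j] S_Suc[of "Suc n" j] by (auto simp: R_def)
        then show ?thesis using Q_bottom[of "Suc j"] 3 that by simp
      qed
      then show ?thesis unfolding hh_edges_eq using 3 by blast
    qed
  qed
  moreover have "vbit n M k j + lbit n M k j + rbit n M k j = 1"
    if "k \<le> n" "1 \<le> j" "j \<le> n + k" for k j
    using that S_Suc[of k "j - 1"] by (simp add: v l r L_def R_def)
  moreover have "vbit n M (Suc k) j + lbit n M k j + rbit n M k (j - 1) = 1"
    if "k \<le> n" "1 \<le> j" "j \<le> n + k + 1" for k j
    using that S_Suc[of "Suc k" "j - 1"] by (simp add: v l r L_def R_def)
  ultimately have M: "M \<in> HH n" unfolding HH_iff by auto
  have "tableau_of n M i j = g i j" for i j
  proof (cases "j \<le> i \<and> i \<le> n")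
    case True
    have "row_positions n M (Suc i) = Q (Suc i)"
      using v[of "Suc i"] Q_bounds[of "Suc i"] True by (auto simp: row_positions_def)
    then show ?thesis
      using enumerates_unique[OF enumerates_tableau_of[OF M, of i]] enum[of i] True by simp
  next
    case False
    then show ?thesis using g by (auto simp: tableau_of_def ST_def)
  qed
  then have "g = tableau_of n M" by (intro ext) simp
  with M show "g \<in> tableau_of n ` HH n" by blast
qed

lemma bij_betw_tableau_of: "bij_betw (tableau_of n) (HH n) (ST n)"
  using inj_on_tableau_of tableau_of_in_ST ST_subset_image[of n] by (auto simp: bij_betw_def)

section \<open>Invariance of the uniform distribution\<close>

theorem proposition4p6:
  fixes n :: nat
  assumes "n \<ge> 1"
  shows "psi (n - 1) (mu (n - 1)) = mu n"
proof
  obtain m where n: "n = m + 1" using assms by (metis le_add_diff_inverse2)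
  note card = bij_betw_same_card[OF bij_betw_tableau_of]
  fix M'
  show "psi (n - 1) (mu (n - 1)) M' = mu n M'"
  proof (cases "M' \<in> HH n")
    case False
    then show ?thesis using n by (simp add: psi_def mu_def)
  next
    case True
    let ?h = "tableau_of (m + 1) M'"
    have h: "?h \<in> ST (m + 1)" using tableau_of_in_ST True n by simp
    \<comment> \<open>The bijection turns the incoming probability of \<open>M'\<close> into the sum
      over tableaux already evaluated.\<close>
    have "(\<Sum>M\<in>HH m. shuffle_prob m M M')
        = (\<Sum>g\<in>ST m. measure_pmf.prob (coins m) {\<xi>. shuffle m g \<xi> = ?h})"
      unfolding shuffle_prob_def by (rule sum.reindex_bij_betw[OF bij_betw_tableau_of])
    also have "\<dots> = 1 / 2 ^ Suc m" by (rule sum_prob_shuffle[OF h])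
    finally have sum: "(\<Sum>M\<in>HH m. shuffle_prob m M M') = 1 / 2 ^ Suc m" .
    have "psi m (mu m) M' = (\<Sum>M\<in>HH m. 1 / of_nat (card (HH m)) * of_real (shuffle_prob m M M'))"
      using True n by (simp add: psi_def mu_def)
    also have "\<dots> = of_real ((\<Sum>M\<in>HH m. shuffle_prob m M M') / real (card (HH m)))"
      by (simp add: sum_divide_distrib)
    \<comment> \<open>The factor \<open>2 ^ Suc m\<close> is the ratio of the two cardinalities by
      \<open>card_ST_Suc\<close>.\<close>
    also have "\<dots> = of_real (1 / real (card (HH (m + 1))))"
      unfolding sum card card_ST_Suc by simp
    finally show ?thesis using True n by (simp add: mu_def)
  qed
qed

end
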